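(* Let $\varphi\in\mathcal{S}(\mathbb{D}^2)$ be a rational inner function on the bidisc with $\varphi(0,0)\neq0$. Then the following are equivalent: (1) There exist finite-dimensional Hilbert spaces $\mathcal{H}_1,\mathcal{H}_2$ and an isometric colligation \[ V=\begin{bmatrix} a & B_1&B_2\\ C_1&D_1&D_2\\ C_2 & 0 & D_3\end{bmatrix}\in\mathcal{B}(\mathbb{C}\oplus\mathcal{H}_1\oplus\mathcal{H}_2) \] with $D_1,D_3\in C_{0\cdot}$ such that $\varphi=\tau_V$. (2) There exist rational inner functions $\varphi_1,\varphi_2\in\mathcal{S}(\mathbb{D})$ such that $\varphi(\mathbf{z})=\varphi_1(z_1)\varphi_2(z_2)$ for all $\mathbf{z}=(z_1,z_2)\in\mathbb{D}^2$.
   Context: $\mathbb{D}$ is the open unit disc and $\mathbb{D}^2$ the open unit bidisc. For $n\geq 1$, $\mathcal{S}(\mathbb{D}^n)$ is the set of Schur functions: analytic functions $\varphi:\mathbb{D}^n\to\mathbb{C}$ with $\sup|\varphi|\le1$. A function $\varphi\in\mathcal{S}(\mathbb{D}^n)$ is inner if $\lim_{r\nearrow1}|\varphi(re^{it_1},\dots,re^{it_n})|=1$ for almost every point $(e^{it_1},\dots,e^{it_n})\in\mathbb{T}^n$; it is rational inner if it is moreover a rational function. $C_{0\cdot}$ denotes the set of all contractions $T$ on Hilbert spaces such that $T^m\to0$ in the strong operator topology as $m\to\infty$. A colligation is a block operator $V=\begin{bmatrix} a & B\\ C& D\end{bmatrix}$ on $\mathbb{C}\oplus(\mathcal{H}_1\oplus\mathcal{H}_2)$,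 with $B=\begin{bmatrix}B_1&B_2\end{bmatrix}$, $C=\begin{bmatrix}C_1\\C_2\end{bmatrix}$ and $D=\begin{bmatrix}D_1&D_2\\0&D_3\end{bmatrix}$ the compression of $V$ to $\mathcal{H}_1\oplus\mathcal{H}_2$. It is isometric if $V^*V=I$. Its transfer function is \[ \tau_V(\mathbf{z})=a+B\,(I_{\mathcal{H}_1\oplus\mathcal{H}_2}-E(\mathbf{z})D)^{-1}E(\mathbf{z})\,C\qquad(\mathbf{z}\in\mathbb{D}^2), \] where $E(\mathbf{z})=z_1I_{\mathcal{H}_1}\oplus z_2I_{\mathcal{H}_2}$. *)

theory Defs
  imports
    "HOL-Analysis.Analysis"
    "HOL-Complex_Analysis.Complex_Analysis"
    "HOL-Computational_Algebra.Polynomial"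
    "Jordan_Normal_Form.Gauss_Jordan_Elimination"
    "Jordan_Normal_Form.Schur_Decomposition"
begin

unbundle no vec_syntax

section \<open>Rational inner functions on the disc and the bidisc\<close>

text \<open>
  Functions on the disc (bidisc) are total functions on \<^typ>\<open>complex\<close>
  (\<^typ>\<open>complex \<times> complex\<close>); only their values on the disc (bidisc) are constrained.
\<close>

abbreviation disc :: "complex set" where
  "disc \<equiv> ball 0 1"

abbreviation bidisc :: "(complex \<times> complex) set" where
  "bidisc \<equiv> disc \<times> disc"

definition schur_disc :: "(complex \<Rightarrow> complex) set" where
  "schur_disc = {f. f holomorphic_on disc \<and> (\<forall>z\<in>disc. cmod (f z) \<le> 1)}"

text \<open>
  Analyticity in two variables: at each point the Frechet derivative exists and is
  complex linear, that is, of the form \<open>(h, k) \<mapsto> b * h + c * k\<close>.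
\<close>

definition analytic_on_bidisc :: "(complex \<times> complex \<Rightarrow> complex) \<Rightarrow> bool" where
  "analytic_on_bidisc f \<longleftrightarrow>
     (\<forall>z\<in>bidisc. \<exists>b c. (f has_derivative (\<lambda>(h, k). b * h + c * k)) (at z))"

definition schur_bidisc :: "(complex \<times> complex \<Rightarrow> complex) set" where
  "schur_bidisc = {f. analytic_on_bidisc f \<and> (\<forall>z\<in>bidisc. cmod (f z) \<le> 1)}"

text \<open>
  Null sets of the torus are described through the angles: by periodicity, a property
  holds almost everywhere on the circle (2-torus) iff it holds for Lebesgue almost every
  real \<open>t\<close> (pair \<open>(s, t)\<close> of reals).
\<close>

definition inner_disc :: "(complex \<Rightarrow> complex) \<Rightarrow> bool" where
  "inner_disc f \<longleftrightarrow> f \<in> schur_disc \<and>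
     (AE t in (lborel :: real measure).
        ((\<lambda>r. cmod (f (of_real r * cis t))) \<longlongrightarrow> 1) (at_left (1 :: real)))"

definition inner_bidisc :: "(complex \<times> complex \<Rightarrow> complex) \<Rightarrow> bool" where
  "inner_bidisc f \<longleftrightarrow> f \<in> schur_bidisc \<and>
     (AE t in (lborel :: (real \<times> real) measure).
        ((\<lambda>r. cmod (f (of_real r * cis (fst t), of_real r * cis (snd t)))) \<longlongrightarrow> 1)
          (at_left (1 :: real)))"

text \<open>
  A function is rational if it is a quotient of two polynomials with nonzero denominator.
  The quotient is only asked to agree with the function where the denominator does not
  vanish.
\<close>

definition rational_on_disc :: "(complex \<Rightarrow> complex) \<Rightarrow> bool" where
  "rational_on_disc f \<longleftrightarrow>
     (\<exists>p q :: complex poly. q \<noteq> 0 \<and>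
        (\<forall>z\<in>disc. poly q z \<noteq> 0 \<longrightarrow> f z = poly p z / poly q z))"

text \<open>
  Polynomials in two variables are represented as polynomials in the second variable
  whose coefficients are polynomials in the first variable.
\<close>

definition poly_pair :: "complex poly poly \<Rightarrow> complex \<times> complex \<Rightarrow> complex" where
  "poly_pair p z = poly (poly p [:snd z:]) (fst z)"

definition rational_on_bidisc :: "(complex \<times> complex \<Rightarrow> complex) \<Rightarrow> bool" where
  "rational_on_bidisc f \<longleftrightarrow>
     (\<exists>p q :: complex poly poly. q \<noteq> 0 \<and>
        (\<forall>z\<in>bidisc. poly_pair q z \<noteq> 0 \<longrightarrow> f z = poly_pair p z / poly_pair q z))"

definition rational_inner_disc :: "(complex \<Rightarrow> complex) \<Rightarrow> bool" where
  "rational_inner_disc f \<longleftrightarrow> inner_disc f \<and> rational_on_disc f"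

definition rational_inner_bidisc :: "(complex \<times> complex \<Rightarrow> complex) \<Rightarrow> bool" where
  "rational_inner_bidisc f \<longleftrightarrow> inner_bidisc f \<and> rational_on_bidisc f"


section \<open>Colligations on finite-dimensional Hilbert spaces\<close>

text \<open>
  A Hilbert space of finite dimension \<open>n\<close> (possibly \<open>0\<close>) is taken to be \<open>\<complex>\<^sup>n\<close> with its
  standard inner product, and operators are matrices.
\<close>

definition l2_norm_vec :: "complex Matrix.vec \<Rightarrow> real" where
  "l2_norm_vec v = L2_set (\<lambda>i. cmod (v $ i)) {..<dim_vec v}"

definition contraction_mat :: "nat \<Rightarrow> complex mat \<Rightarrow> bool" where
  "contraction_mat n T \<longleftrightarrow> T \<in> carrier_mat n n \<and>
     (\<forall>v\<in>carrier_vec n. l2_norm_vec (T *\<^sub>v v) \<le> l2_norm_vec v)"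

text \<open>The contractions on \<open>\<complex>\<^sup>n\<close> of class \<open>C\<^sub>0\<^sub>\<cdot>\<close>: the powers tend strongly to \<open>0\<close>.\<close>

definition class_C0 :: "nat \<Rightarrow> complex mat set" where
  "class_C0 n = {T. contraction_mat n T \<and>
     (\<forall>v\<in>carrier_vec n. (\<lambda>m. l2_norm_vec ((T ^\<^sub>m m) *\<^sub>v v)) \<longlonglongrightarrow> 0)}"

definition isometric_mat :: "complex mat \<Rightarrow> bool" where
  "isometric_mat V \<longleftrightarrow> mat_adjoint V * V = 1\<^sub>m (dim_col V)"

definition block_row :: "complex mat \<Rightarrow> complex mat \<Rightarrow> complex mat" where
  "block_row A B = four_block_mat A B (0\<^sub>m 0 (dim_col A)) (0\<^sub>m 0 (dim_col B))"

definition colligation :: "complex \<Rightarrow> complex mat \<Rightarrow> complex mat \<Rightarrow> complex mat \<Rightarrow> complex mat" where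
  "colligation a B C D = four_block_mat (mat 1 1 (\<lambda>_. a)) B C D"

definition E_mat :: "nat \<Rightarrow> nat \<Rightarrow> complex \<times> complex \<Rightarrow> complex mat" where
  "E_mat n1 n2 z =
     four_block_mat (fst z \<cdot>\<^sub>m 1\<^sub>m n1) (0\<^sub>m n1 n2) (0\<^sub>m n2 n1) (snd z \<cdot>\<^sub>m 1\<^sub>m n2)"

text \<open>
  The transfer function of a matrix \<open>V\<close> acting on \<open>\<complex> \<oplus> (\<complex>\<^bsup>n1\<^esup> \<oplus> \<complex>\<^bsup>n2\<^esup>)\<close>. For a contraction \<open>V\<close>
  and \<open>z\<close> in the bidisc the matrix \<open>I - E(z) D\<close> is invertible, so that
  \<^const>\<open>mat_inverse\<close> does return its inverse.
\<close>

definition transfer_function ::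
    "nat \<Rightarrow> nat \<Rightarrow> complex mat \<Rightarrow> complex \<times> complex \<Rightarrow> complex" where
  "transfer_function n1 n2 V z =
     (let (A, B, C, D) = split_block V 1 1;
          E = E_mat n1 n2 z
      in (A + B * the (mat_inverse (1\<^sub>m (n1 + n2) - E * D)) * E * C) $$ (0, 0))"

end

(*
  In finite dimensions the functions with an isometric one-variable realization whose state
  operator is of class C_0. are exactly the rational inner functions on the disc: the identity
  |f(z)|^2 = 1 - (1 - |z|^2) |(I - z D)^{-1} c|^2 gives one direction, finite Blaschke products
  built by series connection the other.  For two variables, the zero block below D1 together with
  a = phi(0,0) <> 0 forces a * D2 = C1 * B2, and this says precisely that V is the series
  connection of a one-variable isometric colligation in z1 with one in z2.
*)
theory Submission
  imports Defs
begin

text \<open>The algebra works with the state equation y = E(z) (c + D y) instead of the inverse of I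
  - E(z) D: for a series connection a solution is written down from the solutions of the two parts,
  and invertibility of I - E(z) D identifies it with the vector in the transfer function. In the
  splitting direction the condition a \<noteq> 0 enters through D1: it makes D1 injective, hence
  onto in finite dimension, so a vector orthogonal to the range of D1 is 0, and this determines D2.
  In the other direction the obstacle is that a rational function is given only off the zeros of its
  denominator, and its boundary modulus only almost everywhere and along radii. A fraction without
  common zeros together with |f| \<le> 1 excludes poles from the closed disc, after which numerator
  and denominator can be compared at every point of the circle. Class C_0. plays the matching role
  for realizations: it makes I - z D invertible on the circle as well, so the norm identity holds up
  to the boundary.\<close>

unbundle no fps_syntax and no inner_syntax

section \<open>Inner products and norms of complex vectors\<close>

lemma zero_mult_mat_vec:
  fixes v :: "'a :: semiring_0 Matrix.vec"
  assumes "v \<in> carrier_vec n"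
  shows "0\<^sub>m m n *\<^sub>v v = 0\<^sub>v m"
  using assms by (intro eq_vecI) auto

lemma smult_mat_mult_vec:
  fixes A :: "'a :: comm_semiring_0 mat"
  assumes "A \<in> carrier_mat m n" "v \<in> carrier_vec n"
  shows "(k \<cdot>\<^sub>m A) *\<^sub>v v = k \<cdot>\<^sub>v (A *\<^sub>v v)"
  using assms by (intro eq_vecI) (auto simp: scalar_prod_def sum_distrib_left mult.assoc)

lemma mult_mat_zero_vec:
  fixes M :: "'a :: semiring_0 mat"
  assumes "M \<in> carrier_mat m n"
  shows "M *\<^sub>v 0\<^sub>v n = 0\<^sub>v m"
  using assms by (intro eq_vecI) auto

lemma cscalar_prod_eq_sum:
  fixes u v :: "complex Matrix.vec"
  assumes "v \<in> carrier_vec n"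
  shows "u \<bullet>c v = (\<Sum>i<n. u $ i * cnj (v $ i))"
  using assms by (simp add: scalar_prod_def lessThan_atLeast0)

lemma cscalar_prod_add_left:
  fixes u v w :: "complex Matrix.vec"
  assumes "u \<in> carrier_vec n" "v \<in> carrier_vec n" "w \<in> carrier_vec n"
  shows "(u + v) \<bullet>c w = u \<bullet>c w + v \<bullet>c w"
  using assms by (simp add: cscalar_prod_eq_sum[of _ n] distrib_right sum.distrib)

lemma cscalar_prod_add_right:
  fixes u v w :: "complex Matrix.vec"
  assumes "u \<in> carrier_vec n" "v \<in> carrier_vec n" "w \<in> carrier_vec n"
  shows "w \<bullet>c (u + v) = w \<bullet>c u + w \<bullet>c v"
  using assms by (simp add: cscalar_prod_eq_sum[of _ n] distrib_left sum.distrib)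

lemma cscalar_prod_smult_left:
  fixes u v :: "complex Matrix.vec"
  assumes "u \<in> carrier_vec n" "v \<in> carrier_vec n"
  shows "(x \<cdot>\<^sub>v u) \<bullet>c v = x * (u \<bullet>c v)"
  using assms by (simp add: cscalar_prod_eq_sum[of _ n] sum_distrib_left mult.assoc)

lemma cscalar_prod_smult_right:
  fixes u v :: "complex Matrix.vec"
  assumes "u \<in> carrier_vec n" "v \<in> carrier_vec n"
  shows "u \<bullet>c (x \<cdot>\<^sub>v v) = cnj x * (u \<bullet>c v)"
  using assms by (simp add: cscalar_prod_eq_sum[of _ n] sum_distrib_left ac_simps)

lemma cscalar_prod_append:
  fixes u1 u2 v1 v2 :: "complex Matrix.vec"
  assumes "u1 \<in> carrier_vec n1" "u2 \<in> carrier_vec n2" "v1 \<in> carrier_vec n1" "v2 \<in> carrier_vec n2"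
  shows "(u1 @\<^sub>v u2) \<bullet>c (v1 @\<^sub>v v2) = u1 \<bullet>c v1 + u2 \<bullet>c v2"
proof -
  have "conjugate (v1 @\<^sub>v v2) = conjugate v1 @\<^sub>v conjugate v2"
    using assms by (intro eq_vecI) auto
  then show ?thesis
    using assms by (simp add: scalar_prod_append[of _ n1 _ n2])
qed

lemmas cscalar_prod_simps =
  cscalar_prod_add_left cscalar_prod_add_right cscalar_prod_smult_left cscalar_prod_smult_right

lemma cscalar_prod_commute:
  fixes u v :: "complex Matrix.vec"
  assumes "u \<in> carrier_vec n" "v \<in> carrier_vec n"
  shows "u \<bullet>c v = cnj (v \<bullet>c u)"
  using assms by (simp add: cscalar_prod_eq_sum[of _ n] mult.commute)

lemma l2_norm_vec_nonneg: "0 \<le> l2_norm_vec v"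
  by (simp add: l2_norm_vec_def L2_set_nonneg)

lemma cscalar_prod_self:
  "v \<bullet>c v = of_real ((l2_norm_vec v)\<^sup>2)"
proof -
  have "v \<bullet>c v = (\<Sum>i<dim_vec v. of_real ((cmod (v $ i))\<^sup>2))"
    by (subst cscalar_prod_eq_sum[of v "dim_vec v"]) (simp_all add: complex_norm_square flip: of_real_power)
  also have "\<dots> = of_real ((l2_norm_vec v)\<^sup>2)"
    by (simp add: l2_norm_vec_def L2_set_def sum_nonneg)
  finally show ?thesis .
qed

lemma l2_norm_vec_eq_0_iff:
  assumes "v \<in> carrier_vec n"
  shows "l2_norm_vec v = 0 \<longleftrightarrow> v = 0\<^sub>v n"
  using conjugate_square_eq_0_vec[OF assms] by (simp add: cscalar_prod_self del: conjugate_square_eq_0_vec)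

lemma l2_norm_vec_add_le:
  assumes "u \<in> carrier_vec n" "v \<in> carrier_vec n"
  shows "l2_norm_vec (u + v) \<le> l2_norm_vec u + l2_norm_vec v"
proof -
  have "l2_norm_vec (u + v) \<le> L2_set (\<lambda>i. cmod (u $ i) + cmod (v $ i)) {..<n}"
    using assms unfolding l2_norm_vec_def by (auto intro!: L2_set_mono norm_triangle_ineq)
  also have "\<dots> \<le> l2_norm_vec u + l2_norm_vec v"
    using assms L2_set_triangle_ineq[of "\<lambda>i. cmod (u $ i)" "\<lambda>i. cmod (v $ i)" "{..<n}"]
    by (simp add: l2_norm_vec_def)
  finally show ?thesis .
qed

lemma l2_norm_vec_smult: "l2_norm_vec (x \<cdot>\<^sub>v v) = cmod x * l2_norm_vec v"
  by (auto simp: l2_norm_vec_def norm_mult L2_set_right_distrib intro!: L2_set_cong)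

lemma l2_norm_vec_append:
  "(l2_norm_vec (u @\<^sub>v v))\<^sup>2 = (l2_norm_vec u)\<^sup>2 + (l2_norm_vec v)\<^sup>2"
proof -
  have "u \<in> carrier_vec (dim_vec u)" "v \<in> carrier_vec (dim_vec v)" by auto
  from cscalar_prod_append[OF this this]
  have "complex_of_real ((l2_norm_vec (u @\<^sub>v v))\<^sup>2) = of_real ((l2_norm_vec u)\<^sup>2 + (l2_norm_vec v)\<^sup>2)"
    by (simp only: cscalar_prod_self of_real_add)
  then show ?thesis by (simp only: of_real_eq_iff)
qed

lemma l2_norm_vec_append_zero:
  "l2_norm_vec (v @\<^sub>v 0\<^sub>v m) = l2_norm_vec v" "l2_norm_vec (0\<^sub>v m @\<^sub>v v) = l2_norm_vec v"
proof -
  have "l2_norm_vec (0\<^sub>v m) = 0"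
    by (simp add: l2_norm_vec_eq_0_iff[of _ m])
  then show "l2_norm_vec (v @\<^sub>v 0\<^sub>v m) = l2_norm_vec v" "l2_norm_vec (0\<^sub>v m @\<^sub>v v) = l2_norm_vec v"
    using l2_norm_vec_append[of v "0\<^sub>v m"] l2_norm_vec_append[of "0\<^sub>v m" v]
    by (simp_all add: power2_eq_iff_nonneg l2_norm_vec_nonneg)
qed

section \<open>Adjoints, isometric matrices and isometric systems\<close>

lemma mat_adjoint_index:
  assumes "i < dim_col V" "j < dim_row V"
  shows "mat_adjoint V $$ (i, j) = conjugate (V $$ (j, i))"
  using assms by (simp add: mat_adjoint_def mat_of_rows_index)

lemma mat_adjoint_carrier:
  assumes "V \<in> carrier_mat m n"
  shows "mat_adjoint V \<in> carrier_mat n m"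
  using assms unfolding mat_adjoint_def by auto

lemma cscalar_prod_mat_adjoint:
  fixes V :: "complex mat"
  assumes "V \<in> carrier_mat m n" "u \<in> carrier_vec n" "w \<in> carrier_vec m"
  shows "(V *\<^sub>v u) \<bullet>c w = u \<bullet>c (mat_adjoint V *\<^sub>v w)"
proof -
  have "(V *\<^sub>v u) \<bullet>c w = (\<Sum>k<m. (\<Sum>i<n. V $$ (k, i) * u $ i) * cnj (w $ k))"
    using assms by (simp add: cscalar_prod_eq_sum[of _ m] scalar_prod_def lessThan_atLeast0)
  also have "\<dots> = (\<Sum>i<n. u $ i * (\<Sum>k<m. V $$ (k, i) * cnj (w $ k)))"
    unfolding sum_distrib_left sum_distrib_right
    by (subst sum.swap) (simp add: ac_simps)
  also have "\<dots> = u \<bullet>c (mat_adjoint V *\<^sub>v w)"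
    using assms mat_adjoint_carrier[OF assms(1)]
    by (simp add: cscalar_prod_eq_sum[of _ n] scalar_prod_def lessThan_atLeast0 mat_adjoint_index)
  finally show ?thesis .
qed

text \<open>The entries of V* V are the inner products of the images of unit vectors. The form with
  two vectors, rather than norms, is kept because the splitting of V later reads off orthogonality
  relations between its columns.\<close>

lemma isometric_mat_iff:
  assumes V: "V \<in> carrier_mat m n"
  shows "isometric_mat V \<longleftrightarrow>
    (\<forall>u\<in>carrier_vec n. \<forall>v\<in>carrier_vec n. (V *\<^sub>v u) \<bullet>c (V *\<^sub>v v) = u \<bullet>c v)" (is "_ \<longleftrightarrow> ?R")
proof
  assume iso: "isometric_mat V"
  show ?R
  proof (intro ballI)
    fix u v :: "complex Matrix.vec" assume u: "u \<in> carrier_vec n" and v: "v \<in> carrier_vec n"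
    have "(V *\<^sub>v u) \<bullet>c (V *\<^sub>v v) = u \<bullet>c ((mat_adjoint V * V) *\<^sub>v v)"
      using cscalar_prod_mat_adjoint[OF V u, of "V *\<^sub>v v"]
        assoc_mult_mat_vec[OF mat_adjoint_carrier[OF V] V v] V v by simp
    then show "(V *\<^sub>v u) \<bullet>c (V *\<^sub>v v) = u \<bullet>c v"
      using iso V v by (simp add: isometric_mat_def)
  qed
next
  assume R: ?R
  show "isometric_mat V"
    unfolding isometric_mat_def
  proof (rule eq_matI)
    fix i j assume "i < dim_row (1\<^sub>m (dim_col V) :: complex mat)" "j < dim_col (1\<^sub>m (dim_col V) :: complex mat)"
    then have ij: "i < n" "j < n" using V by auto
    have u: "unit_vec n k \<in> carrier_vec n" for k by simp
    have 1: "(V *\<^sub>v unit_vec n j) \<bullet>c (V *\<^sub>v unit_vec n i) = unit_vec n j \<bullet>c (unit_vec n i :: complex Matrix.vec)"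
      using R u by auto
    have 2: "V *\<^sub>v unit_vec n k = col V k" if "k < n" for k
      using V that by (intro eq_vecI) auto
    have 3: "unit_vec n j \<bullet>c (unit_vec n i :: complex Matrix.vec) = (if i = j then 1 else 0)"
      using ij by simp
    have "(mat_adjoint V * V) $$ (i, j) = row (mat_adjoint V) i \<bullet> col V j"
      using V mat_adjoint_carrier[OF V] ij by simp
    also have "row (mat_adjoint V) i = conjugate (col V i)"
      using V mat_adjoint_carrier[OF V] ij by (intro eq_vecI) (simp_all add: mat_adjoint_index)
    also have "conjugate (col V i) \<bullet> col V j = col V j \<bullet>c col V i"
      using V by (intro comm_scalar_prod[of _ m]) auto
    finally show "(mat_adjoint V * V) $$ (i, j) = 1\<^sub>m (dim_col V) $$ (i, j)"
      using 1 2 3 V ij by simp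
  qed (use V mat_adjoint_carrier[OF V] in auto)
qed

text \<open>
  The isometry of \<open>[[a, b\<^sup>T], [c, D]]\<close> on \<open>\<complex> \<oplus> \<complex>\<^bsup>n\<^esup>\<close>, with row \<open>b\<close> and column \<open>c\<close>, expressed as
  preservation of the inner product; in this form it can be checked by substitution instead of
  block matrix algebra.
\<close>

definition isometric_system ::
    "nat \<Rightarrow> complex \<Rightarrow> complex Matrix.vec \<Rightarrow> complex Matrix.vec \<Rightarrow> complex mat \<Rightarrow> bool" where
  "isometric_system n a b c D \<longleftrightarrow>
     b \<in> carrier_vec n \<and> c \<in> carrier_vec n \<and> D \<in> carrier_mat n n \<and>
     (\<forall>x x'. \<forall>h\<in>carrier_vec n. \<forall>h'\<in>carrier_vec n.
        (a * x + b \<bullet> h) * cnj (a * x' + b \<bullet> h') + (x \<cdot>\<^sub>v c + D *\<^sub>v h) \<bullet>c (x' \<cdot>\<^sub>v c + D *\<^sub>v h')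
          = x * cnj x' + h \<bullet>c h')"

lemma isometric_colligation_iff:
  assumes "B \<in> carrier_mat 1 n" "C \<in> carrier_mat n 1" "D \<in> carrier_mat n n"
  shows "isometric_mat (colligation a B C D) \<longleftrightarrow> isometric_system n a (row B 0) (col C 0) D"
proof -
  let ?V = "colligation a B C D"
  have V: "?V \<in> carrier_mat (1 + n) (1 + n)"
    using assms four_block_carrier_mat[of "mat 1 1 (\<lambda>_. a)" 1 1 D n n] by (simp add: colligation_def)
  have mult: "?V *\<^sub>v (vec 1 (\<lambda>_. x) @\<^sub>v h) =
      vec 1 (\<lambda>_. a * x + row B 0 \<bullet> h) @\<^sub>v (x \<cdot>\<^sub>v col C 0 + D *\<^sub>v h)"
    if "h \<in> carrier_vec n" for x h
  proof -
    have "?V *\<^sub>v (vec 1 (\<lambda>_. x) @\<^sub>v h) =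
      (mat 1 1 (\<lambda>_. a) *\<^sub>v vec 1 (\<lambda>_. x) + B *\<^sub>v h) @\<^sub>v (C *\<^sub>v vec 1 (\<lambda>_. x) + D *\<^sub>v h)"
      unfolding colligation_def
      by (rule four_block_mat_mult_vec[of _ 1 1 _ n _ n]) (use assms that in auto)
    moreover have "mat 1 1 (\<lambda>_. a) *\<^sub>v vec 1 (\<lambda>_. x) + B *\<^sub>v h = vec 1 (\<lambda>_. a * x + row B 0 \<bullet> h)"
      using assms that by (intro eq_vecI) (auto simp: scalar_prod_def)
    moreover have "C *\<^sub>v vec 1 (\<lambda>_. x) = x \<cdot>\<^sub>v col C 0"
      using assms by (intro eq_vecI) (auto simp: scalar_prod_def)
    ultimately show ?thesis by simp
  qed
  have prod: "(vec 1 (\<lambda>_. x) @\<^sub>v h) \<bullet>c (vec 1 (\<lambda>_. x') @\<^sub>v h') = x * cnj x' + h \<bullet>c h'"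
    if "h \<in> carrier_vec n" "h' \<in> carrier_vec n" for x x' h h'
    using that by (subst cscalar_prod_append[of _ 1 _ n]) (auto simp: cscalar_prod_eq_sum[of _ 1])
  have all1: "(\<forall>v\<in>carrier_vec 1. P v) \<longleftrightarrow> (\<forall>x. P (vec 1 (\<lambda>_. x)))" for P :: "complex Matrix.vec \<Rightarrow> bool"
  proof safe
    fix v :: "complex Matrix.vec" assume "\<forall>x. P (vec 1 (\<lambda>_. x))" "v \<in> carrier_vec 1"
    moreover from this have "v = vec 1 (\<lambda>_. v $ 0)" by (intro eq_vecI) auto
    ultimately show "P v" by metis
  qed auto
  have "x \<cdot>\<^sub>v col C 0 + D *\<^sub>v h \<in> carrier_vec n" if "h \<in> carrier_vec n" for x h
    using assms that by auto
  moreover have "row B 0 \<in> carrier_vec n" "col C 0 \<in> carrier_vec n"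
    using assms by auto
  ultimately show ?thesis
    unfolding isometric_mat_iff[OF V] all_vec_append all1 isometric_system_def
    using assms by (auto simp: mult prod simp del: One_nat_def)
qed

section \<open>Energy balance, contractions and the class C_0\<close>

lemma class_C0_carrier: "D \<in> class_C0 n \<Longrightarrow> D \<in> carrier_mat n n"
  by (simp add: class_C0_def contraction_mat_def)

text \<open>Energy balance: output and new state together carry the energy of input x and old state
  h. Input 0 shows that D is a contraction; input 1 gives the norm identity for the transfer
  function.\<close>

lemma isometric_system_norm:
  assumes "isometric_system n a b c D" "h \<in> carrier_vec n"
  shows "(cmod (a * x + b \<bullet> h))\<^sup>2 + (l2_norm_vec (x \<cdot>\<^sub>v c + D *\<^sub>v h))\<^sup>2 = (cmod x)\<^sup>2 + (l2_norm_vec h)\<^sup>2"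
proof -
  have "(a * x + b \<bullet> h) * cnj (a * x + b \<bullet> h) + (x \<cdot>\<^sub>v c + D *\<^sub>v h) \<bullet>c (x \<cdot>\<^sub>v c + D *\<^sub>v h)
    = x * cnj x + h \<bullet>c h"
    using assms by (simp add: isometric_system_def)
  then have "of_real ((cmod (a * x + b \<bullet> h))\<^sup>2 + (l2_norm_vec (x \<cdot>\<^sub>v c + D *\<^sub>v h))\<^sup>2)
    = (of_real ((cmod x)\<^sup>2 + (l2_norm_vec h)\<^sup>2) :: complex)"
    unfolding cscalar_prod_self by (simp only: of_real_add complex_norm_square)
  then show ?thesis
    by (simp only: of_real_eq_iff)
qed

lemma contraction_isometric_system:
  assumes "isometric_system n a b c D"
  shows "contraction_mat n D"
proof -
  have D: "D \<in> carrier_mat n n" and c: "c \<in> carrier_vec n"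
    using assms by (auto simp: isometric_system_def)
  have "l2_norm_vec (D *\<^sub>v v) \<le> l2_norm_vec v" if v: "v \<in> carrier_vec n" for v
  proof -
    have "0 \<cdot>\<^sub>v c + D *\<^sub>v v = D *\<^sub>v v"
      using D c v by (intro eq_vecI) auto
    then have "(l2_norm_vec (D *\<^sub>v v))\<^sup>2 \<le> (l2_norm_vec v)\<^sup>2"
      using isometric_system_norm[OF assms v, of 0] by (smt (verit) norm_zero zero_le_power2 zero_power2)
    then show ?thesis
      by (rule power2_le_imp_le) (rule l2_norm_vec_nonneg)
  qed
  with D show ?thesis
    by (simp add: contraction_mat_def)
qed

lemma contraction_mat_pow:
  assumes "contraction_mat n T"
  shows "contraction_mat n (T ^\<^sub>m k)"
proof (induction k)
  case 0
  then show ?case using assms by (auto simp: contraction_mat_def)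
next
  case (Suc k)
  have T: "T \<in> carrier_mat n n" using assms by (simp add: contraction_mat_def)
  have "l2_norm_vec ((T ^\<^sub>m k * T) *\<^sub>v v) \<le> l2_norm_vec v" if v: "v \<in> carrier_vec n" for v
  proof -
    have "(T ^\<^sub>m k * T) *\<^sub>v v = T ^\<^sub>m k *\<^sub>v (T *\<^sub>v v)"
      using assoc_mult_mat_vec[OF pow_carrier_mat[OF T] T v] .
    also have "l2_norm_vec \<dots> \<le> l2_norm_vec (T *\<^sub>v v)"
      using Suc T v by (auto simp: contraction_mat_def)
    also have "\<dots> \<le> l2_norm_vec v"
      using assms v by (auto simp: contraction_mat_def)
    finally show ?thesis .
  qed
  moreover have "T ^\<^sub>m k * T \<in> carrier_mat n n"
    using pow_carrier_mat[OF T] T by (rule mult_carrier_mat)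
  ultimately show ?case by (simp add: contraction_mat_def)
qed

text \<open>State operators of series connections have this block form. The off-diagonal block of a
  power is a long sum of mixed products; contractivity of the whole matrix avoids estimating
  it.\<close>

lemma class_C0_upper_triangular:
  assumes D1: "D1 \<in> class_C0 n1" and D2: "D2 \<in> class_C0 n2" and M: "M \<in> carrier_mat n1 n2"
    and contr: "contraction_mat (n1 + n2) (four_block_mat D1 M (0\<^sub>m n2 n1) D2)"
  shows "four_block_mat D1 M (0\<^sub>m n2 n1) D2 \<in> class_C0 (n1 + n2)"
proof -
  define T where "T = four_block_mat D1 M (0\<^sub>m n2 n1) D2"
  note D1c = class_C0_carrier[OF D1] and D2c = class_C0_carrier[OF D2]
  have T: "T \<in> carrier_mat (n1 + n2) (n1 + n2)"
    using contr by (simp add: contraction_mat_def T_def)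
  have T_append: "T *\<^sub>v (u @\<^sub>v v) = (D1 *\<^sub>v u + M *\<^sub>v v) @\<^sub>v (D2 *\<^sub>v v)"
    if "u \<in> carrier_vec n1" "v \<in> carrier_vec n2" for u v
    unfolding T_def using that D2c
    by (subst four_block_mat_mult_vec[OF D1c M zero_carrier_mat D2c that]) (simp add: zero_mult_mat_vec)
  \<comment> \<open>\<open>pow_mat\<close> adds the new factor on the right, where it acts first. To
    follow the trajectory w, X w, X (X w), ... it has to act last.\<close>
  have pow_Suc: "X ^\<^sub>m Suc k *\<^sub>v w = X *\<^sub>v (X ^\<^sub>m k *\<^sub>v w)"
    if X: "X \<in> carrier_mat n n" and w: "w \<in> carrier_vec n" for X :: "complex mat" and n k w
    using w
  proof (induction k arbitrary: w)
    case (Suc k)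
    have "X ^\<^sub>m Suc (Suc k) *\<^sub>v w = X ^\<^sub>m Suc k *\<^sub>v (X *\<^sub>v w)"
      using assoc_mult_mat_vec[OF pow_carrier_mat[OF X] X Suc.prems, of "Suc k"] by simp
    also have "\<dots> = X *\<^sub>v (X ^\<^sub>m k *\<^sub>v (X *\<^sub>v w))"
      using Suc X by simp
    also have "X ^\<^sub>m k *\<^sub>v (X *\<^sub>v w) = X ^\<^sub>m Suc k *\<^sub>v w"
      using assoc_mult_mat_vec[OF pow_carrier_mat[OF X] X Suc.prems, of k] by simp
    finally show ?case .
  qed (use X in simp)
  have pow_add: "T ^\<^sub>m (k + l) *\<^sub>v w = T ^\<^sub>m k *\<^sub>v (T ^\<^sub>m l *\<^sub>v w)"
    if w: "w \<in> carrier_vec (n1 + n2)" for k l w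
  proof (induction k)
    case 0
    have "T ^\<^sub>m l *\<^sub>v w \<in> carrier_vec (n1 + n2)"
      by (rule mult_mat_vec_carrier[OF pow_carrier_mat[OF T] w])
    then show ?case using T by simp
  next
    case (Suc k)
    have "T ^\<^sub>m l *\<^sub>v w \<in> carrier_vec (n1 + n2)"
      by (rule mult_mat_vec_carrier[OF pow_carrier_mat[OF T] w])
    then show ?case using Suc w by (simp del: pow_mat.simps add: pow_Suc[OF T])
  qed
  have pow_first: "T ^\<^sub>m k *\<^sub>v (u @\<^sub>v 0\<^sub>v n2) = (D1 ^\<^sub>m k *\<^sub>v u) @\<^sub>v 0\<^sub>v n2"
    if u: "u \<in> carrier_vec n1" for u k
  proof (induction k)
    case 0
    then show ?case using T D1c u by simp
  next
    case (Suc k)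
    have "D1 ^\<^sub>m k *\<^sub>v u \<in> carrier_vec n1"
      by (rule mult_mat_vec_carrier[OF pow_carrier_mat[OF D1c] u])
    then show ?case
      using u Suc D1c D2c M by (simp del: pow_mat.simps add: pow_Suc[OF T] pow_Suc[OF D1c u] T_append mult_mat_zero_vec[OF M] mult_mat_zero_vec[OF D2c])
  qed
  have pow_second: "\<exists>x\<in>carrier_vec n1. T ^\<^sub>m k *\<^sub>v (u @\<^sub>v v) = x @\<^sub>v (D2 ^\<^sub>m k *\<^sub>v v)"
    if u: "u \<in> carrier_vec n1" and v: "v \<in> carrier_vec n2" for u v k
  proof (induction k)
    case 0
    then show ?case using T D2c u v by auto
  next
    case (Suc k)
    then obtain x where x: "x \<in> carrier_vec n1" "T ^\<^sub>m k *\<^sub>v (u @\<^sub>v v) = x @\<^sub>v (D2 ^\<^sub>m k *\<^sub>v v)" by blast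
    have "D2 ^\<^sub>m k *\<^sub>v v \<in> carrier_vec n2"
      by (rule mult_mat_vec_carrier[OF pow_carrier_mat[OF D2c] v])
    then show ?case
      using x u v D1c M
      by (intro bexI[of _ "D1 *\<^sub>v x + M *\<^sub>v (D2 ^\<^sub>m k *\<^sub>v v)"])
        (auto simp del: pow_mat.simps simp add: pow_Suc[OF T] pow_Suc[OF D2c v] T_append)
  qed
  txt \<open>
    Wait until the second component is small; from then on it contributes little because \<open>T\<close> is a
    contraction, and the first component evolves under \<open>D1\<close> alone.
  \<close>
  have "(\<lambda>m. l2_norm_vec (T ^\<^sub>m m *\<^sub>v w)) \<longlonglongrightarrow> 0" if w: "w \<in> carrier_vec (n1 + n2)" for w
  proof (rule LIMSEQ_I)
    fix e :: real assume e: "e > 0"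
    define u v where "u = vec_first w n1" and "v = vec_last w n2"
    have uv: "u \<in> carrier_vec n1" "v \<in> carrier_vec n2" "w = u @\<^sub>v v"
      using w by (auto simp: u_def v_def)
    have "(\<lambda>m. l2_norm_vec (D2 ^\<^sub>m m *\<^sub>v v)) \<longlonglongrightarrow> 0"
      using D2 uv by (simp add: class_C0_def)
    from LIMSEQ_D[OF this, of "e/2"] e obtain N where N: "l2_norm_vec (D2 ^\<^sub>m N *\<^sub>v v) < e / 2"
      by (auto simp: l2_norm_vec_nonneg)
    obtain x where x: "x \<in> carrier_vec n1" "T ^\<^sub>m N *\<^sub>v w = x @\<^sub>v (D2 ^\<^sub>m N *\<^sub>v v)"
      using pow_second[OF uv(1,2), of N] uv(3) by blast
    have "(\<lambda>m. l2_norm_vec (D1 ^\<^sub>m m *\<^sub>v x)) \<longlonglongrightarrow> 0"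
      using D1 x by (simp add: class_C0_def)
    from LIMSEQ_D[OF this, of "e/2"] e obtain K where K: "\<And>k. k \<ge> K \<Longrightarrow> l2_norm_vec (D1 ^\<^sub>m k *\<^sub>v x) < e / 2"
      by (auto simp: l2_norm_vec_nonneg)
    have y: "D2 ^\<^sub>m N *\<^sub>v v \<in> carrier_vec n2"
      by (rule mult_mat_vec_carrier[OF pow_carrier_mat[OF D2c] uv(2)])
    have "l2_norm_vec (T ^\<^sub>m m *\<^sub>v w) < e" if m: "m \<ge> K + N" for m
    proof -
      define k where "k = m - N"
      have mk: "m = k + N" "k \<ge> K" using m by (auto simp: k_def)
      have Tk: "T ^\<^sub>m k \<in> carrier_mat (n1 + n2) (n1 + n2)" by (rule pow_carrier_mat[OF T])
      have split: "x @\<^sub>v (D2 ^\<^sub>m N *\<^sub>v v) = (x @\<^sub>v 0\<^sub>v n2) + (0\<^sub>v n1 @\<^sub>v (D2 ^\<^sub>m N *\<^sub>v v))"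
        using x y by (subst append_vec_add[of _ n1 _ _ n2]) auto
      have c1: "x @\<^sub>v 0\<^sub>v n2 \<in> carrier_vec (n1 + n2)" and c2: "0\<^sub>v n1 @\<^sub>v (D2 ^\<^sub>m N *\<^sub>v v) \<in> carrier_vec (n1 + n2)"
        using x y by auto
      have "T ^\<^sub>m m *\<^sub>v w = T ^\<^sub>m k *\<^sub>v (T ^\<^sub>m N *\<^sub>v w)"
        using pow_add[OF w] mk by simp
      also have "\<dots> = T ^\<^sub>m k *\<^sub>v (x @\<^sub>v 0\<^sub>v n2) + T ^\<^sub>m k *\<^sub>v (0\<^sub>v n1 @\<^sub>v (D2 ^\<^sub>m N *\<^sub>v v))"
        unfolding x(2) split by (rule mult_add_distrib_mat_vec[OF Tk c1 c2])
      finally have "l2_norm_vec (T ^\<^sub>m m *\<^sub>v w)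
          \<le> l2_norm_vec (T ^\<^sub>m k *\<^sub>v (x @\<^sub>v 0\<^sub>v n2)) + l2_norm_vec (T ^\<^sub>m k *\<^sub>v (0\<^sub>v n1 @\<^sub>v (D2 ^\<^sub>m N *\<^sub>v v)))"
        using Tk c1 c2 by (auto intro!: l2_norm_vec_add_le[of _ "n1 + n2"])
      moreover have "l2_norm_vec (T ^\<^sub>m k *\<^sub>v (x @\<^sub>v 0\<^sub>v n2)) < e / 2"
        using K[OF mk(2)] by (simp add: pow_first[OF x(1)] l2_norm_vec_append_zero)
      moreover have "l2_norm_vec (T ^\<^sub>m k *\<^sub>v (0\<^sub>v n1 @\<^sub>v (D2 ^\<^sub>m N *\<^sub>v v))) \<le> l2_norm_vec (D2 ^\<^sub>m N *\<^sub>v v)"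
        using contraction_mat_pow[OF contr, folded T_def, of k] c2
        by (metis contraction_mat_def l2_norm_vec_append_zero(2))
      ultimately show ?thesis using N by linarith
    qed
    then show "\<exists>no. \<forall>m\<ge>no. norm (l2_norm_vec (T ^\<^sub>m m *\<^sub>v w) - 0) < e"
      by (auto simp: l2_norm_vec_nonneg intro!: exI[of _ "K + N"])
  qed
  with contr show ?thesis
    by (simp add: class_C0_def T_def)
qed

text \<open>
  Here \<open>y = (I - z D)^{-1} z c\<close>, so \<open>f\<close> is the transfer function \<open>a + b (I - z D)^{-1} z c\<close>.
\<close>

definition realizes ::
    "nat \<Rightarrow> complex \<Rightarrow> complex Matrix.vec \<Rightarrow> complex Matrix.vec \<Rightarrow> complex mat \<Rightarrow> (complex \<Rightarrow> complex) \<Rightarrow> bool"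
  where
  "realizes n a b c D f \<longleftrightarrow> isometric_system n a b c D \<and> D \<in> class_C0 n \<and>
     (\<forall>z\<in>disc. \<exists>y\<in>carrier_vec n. y = z \<cdot>\<^sub>v (c + D *\<^sub>v y) \<and> f z = a + b \<bullet> y)"

section \<open>Series connection of two systems\<close>

text \<open>There is no conjugate on \<open>v\<close>, because the row b of a system acts on states
  through the bilinear product \<open>\<bullet>\<close>.\<close>

definition outer :: "complex Matrix.vec \<Rightarrow> complex Matrix.vec \<Rightarrow> complex mat" where
  "outer u v = mat (dim_vec u) (dim_vec v) (\<lambda>(i, j). u $ i * v $ j)"

lemma outer_carrier: "u \<in> carrier_vec m \<Longrightarrow> v \<in> carrier_vec n \<Longrightarrow> outer u v \<in> carrier_mat m n"
  by (simp add: outer_def)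

lemma outer_mult_vec:
  assumes "u \<in> carrier_vec m" "v \<in> carrier_vec n" "h \<in> carrier_vec n"
  shows "outer u v *\<^sub>v h = (v \<bullet> h) \<cdot>\<^sub>v u"
  using assms by (intro eq_vecI) (auto simp: outer_def scalar_prod_def sum_distrib_left mult_ac)

text \<open>State operator when system 2 feeds system 1: the contribution
  \<open>b2 \<bullet> v\<close> of the second state to the intermediate signal enters the first
  state through \<open>c1\<close>. Nothing flows back, whence the zero block.\<close>

definition cascade_mat :: "complex Matrix.vec \<Rightarrow> complex mat \<Rightarrow> complex Matrix.vec \<Rightarrow> complex mat \<Rightarrow> complex mat"
  where "cascade_mat c1 D1 b2 D2 = four_block_mat D1 (outer c1 b2) (0\<^sub>m (dim_row D2) (dim_col D1)) D2"

lemma cascade_mat_mult_append: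
  assumes "c1 \<in> carrier_vec n1" "D1 \<in> carrier_mat n1 n1" "b2 \<in> carrier_vec n2" "D2 \<in> carrier_mat n2 n2"
    and "u \<in> carrier_vec n1" "v \<in> carrier_vec n2"
  shows "cascade_mat c1 D1 b2 D2 *\<^sub>v (u @\<^sub>v v) = (D1 *\<^sub>v u + (b2 \<bullet> v) \<cdot>\<^sub>v c1) @\<^sub>v (D2 *\<^sub>v v)"
proof -
  have "cascade_mat c1 D1 b2 D2 *\<^sub>v (u @\<^sub>v v)
      = (D1 *\<^sub>v u + outer c1 b2 *\<^sub>v v) @\<^sub>v (0\<^sub>m n2 n1 *\<^sub>v u + D2 *\<^sub>v v)"
    unfolding cascade_mat_def using assms
    by (simp add: four_block_mat_mult_vec[OF assms(2) outer_carrier[OF assms(1,3)] zero_carrier_mat assms(4-6)])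
  then show ?thesis
    using assms by (simp add: outer_mult_vec[OF assms(1,3,6)] zero_mult_mat_vec)
qed

text \<open>
  Series connection: the output of the second system is the input of the first, which multiplies
  the transfer functions.
\<close>

lemma isometric_system_cascade:
  assumes 1: "isometric_system n1 a1 b1 c1 D1" and 2: "isometric_system n2 a2 b2 c2 D2"
  shows "isometric_system (n1 + n2) (a1 * a2) (b1 @\<^sub>v (a1 \<cdot>\<^sub>v b2)) ((a2 \<cdot>\<^sub>v c1) @\<^sub>v c2) (cascade_mat c1 D1 b2 D2)"
proof -
  have car: "b1 \<in> carrier_vec n1" "c1 \<in> carrier_vec n1" "D1 \<in> carrier_mat n1 n1"
    "b2 \<in> carrier_vec n2" "c2 \<in> carrier_vec n2" "D2 \<in> carrier_mat n2 n2"
    using 1 2 by (auto simp: isometric_system_def)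
  let ?b = "b1 @\<^sub>v (a1 \<cdot>\<^sub>v b2)" and ?c = "(a2 \<cdot>\<^sub>v c1) @\<^sub>v c2" and ?D = "cascade_mat c1 D1 b2 D2"
  have D: "?D \<in> carrier_mat (n1 + n2) (n1 + n2)"
    unfolding cascade_mat_def using car four_block_carrier_mat by blast
  have out: "(a1 * a2) * x + ?b \<bullet> (h1 @\<^sub>v h2) = a1 * (a2 * x + b2 \<bullet> h2) + b1 \<bullet> h1"
    if "h1 \<in> carrier_vec n1" "h2 \<in> carrier_vec n2" for x h1 h2
    using car that by (simp add: scalar_prod_append[of _ n1 _ n2] algebra_simps)
  have state: "x \<cdot>\<^sub>v ?c + ?D *\<^sub>v (h1 @\<^sub>v h2)
      = ((a2 * x + b2 \<bullet> h2) \<cdot>\<^sub>v c1 + D1 *\<^sub>v h1) @\<^sub>v (x \<cdot>\<^sub>v c2 + D2 *\<^sub>v h2)"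
    if h: "h1 \<in> carrier_vec n1" "h2 \<in> carrier_vec n2" for x h1 h2
  proof -
    have "x \<cdot>\<^sub>v ?c = (x \<cdot>\<^sub>v (a2 \<cdot>\<^sub>v c1)) @\<^sub>v (x \<cdot>\<^sub>v c2)"
      by (intro eq_vecI) auto
    moreover have "x \<cdot>\<^sub>v (a2 \<cdot>\<^sub>v c1) + (D1 *\<^sub>v h1 + (b2 \<bullet> h2) \<cdot>\<^sub>v c1) = (a2 * x + b2 \<bullet> h2) \<cdot>\<^sub>v c1 + D1 *\<^sub>v h1"
      using car h by (intro eq_vecI) (auto simp: algebra_simps)
    ultimately show ?thesis
      using car h
      by (simp add: cascade_mat_mult_append append_vec_add[of _ n1 _ _ n2])
  qed
  have iso: "(a * x + b \<bullet> h) * cnj (a * x' + b \<bullet> h') + (x \<cdot>\<^sub>v c + D *\<^sub>v h) \<bullet>c (x' \<cdot>\<^sub>v c + D *\<^sub>v h')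
          = x * cnj x' + h \<bullet>c h'"
    if "isometric_system n a b c D" "h \<in> carrier_vec n" "h' \<in> carrier_vec n" for n a b c D x x' h h'
    using that by (simp add: isometric_system_def)
  \<comment> \<open>\<open>W\<close> is the product of the two intermediate signals. It occurs as
    output energy of system 2 and as input energy of system 1, so it cancels when the two balances
    are added.\<close>
  have add_chain: "P + (Q + R) = X + (H1 + H2)" if "P + Q = W + H1" "W + R = X + H2"
    for P Q R W X H1 H2 :: complex
  proof -
    have "P = W + H1 - Q" "R = X + H2 - W"
      using that by (simp_all add: eq_diff_eq add.commute)
    then show ?thesis by simp
  qed
  show ?thesis
    unfolding isometric_system_def all_vec_append
  proof (intro conjI allI ballI)
    fix x x' and h1 h2 h1' h2' :: "complex Matrix.vec"
    assume h: "h1 \<in> carrier_vec n1" "h2 \<in> carrier_vec n2" "h1' \<in> carrier_vec n1" "h2' \<in> carrier_vec n2"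
    let ?w = "a2 * x + b2 \<bullet> h2" and ?w' = "a2 * x' + b2 \<bullet> h2'"
    have c: "?w \<cdot>\<^sub>v c1 + D1 *\<^sub>v h1 \<in> carrier_vec n1" "?w' \<cdot>\<^sub>v c1 + D1 *\<^sub>v h1' \<in> carrier_vec n1"
      "x \<cdot>\<^sub>v c2 + D2 *\<^sub>v h2 \<in> carrier_vec n2" "x' \<cdot>\<^sub>v c2 + D2 *\<^sub>v h2' \<in> carrier_vec n2"
      using car h by auto
    show "((a1 * a2) * x + ?b \<bullet> (h1 @\<^sub>v h2)) * cnj ((a1 * a2) * x' + ?b \<bullet> (h1' @\<^sub>v h2'))
        + (x \<cdot>\<^sub>v ?c + ?D *\<^sub>v (h1 @\<^sub>v h2)) \<bullet>c (x' \<cdot>\<^sub>v ?c + ?D *\<^sub>v (h1' @\<^sub>v h2'))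
        = x * cnj x' + (h1 @\<^sub>v h2) \<bullet>c (h1' @\<^sub>v h2')"
      unfolding out[OF h(1,2)] out[OF h(3,4)] state[OF h(1,2)] state[OF h(3,4)]
        cscalar_prod_append[OF c(1,3,2,4)] cscalar_prod_append[OF h]
      by (rule add_chain[OF iso[OF 1 h(1,3), of ?w ?w'] iso[OF 2 h(2,4), of x x']])
  qed (use car D in auto)
qed

text \<open>System 1 receives the input w instead of 1, so by linearity its state is w times
  \<open>y1\<close>. The points \<open>z1\<close> and \<open>z2\<close> are kept apart so that the
  computation serves both the product of one-variable functions, where they coincide, and the
  bidisc.\<close>

lemma cascade_fixpoint:
  fixes a1 a2 z1 z2 :: complex
  assumes car: "b1 \<in> carrier_vec n1" "c1 \<in> carrier_vec n1" "D1 \<in> carrier_mat n1 n1"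
    "b2 \<in> carrier_vec n2" "c2 \<in> carrier_vec n2" "D2 \<in> carrier_mat n2 n2"
    and y1: "y1 \<in> carrier_vec n1" "y1 = z1 \<cdot>\<^sub>v (c1 + D1 *\<^sub>v y1)"
    and y2: "y2 \<in> carrier_vec n2" "y2 = z2 \<cdot>\<^sub>v (c2 + D2 *\<^sub>v y2)"
    and w: "w = a2 + b2 \<bullet> y2"
    and s_def: "s = ((a2 \<cdot>\<^sub>v c1) @\<^sub>v c2) + cascade_mat c1 D1 b2 D2 *\<^sub>v ((w \<cdot>\<^sub>v y1) @\<^sub>v y2)"
  shows "w \<cdot>\<^sub>v y1 = z1 \<cdot>\<^sub>v vec_first s n1" "y2 = z2 \<cdot>\<^sub>v vec_last s n2"
    "a1 * a2 + (b1 @\<^sub>v (a1 \<cdot>\<^sub>v b2)) \<bullet> ((w \<cdot>\<^sub>v y1) @\<^sub>v y2) = (a1 + b1 \<bullet> y1) * w"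
proof -
  have wy: "w \<cdot>\<^sub>v y1 \<in> carrier_vec n1" using y1 by auto
  have "s = (a2 \<cdot>\<^sub>v c1 + (D1 *\<^sub>v (w \<cdot>\<^sub>v y1) + (b2 \<bullet> y2) \<cdot>\<^sub>v c1)) @\<^sub>v (c2 + D2 *\<^sub>v y2)"
    unfolding s_def cascade_mat_mult_append[OF car(2,3,4,6) wy y2(1)]
    using car wy y2(1) by (intro append_vec_add) auto
  also have "a2 \<cdot>\<^sub>v c1 + (D1 *\<^sub>v (w \<cdot>\<^sub>v y1) + (b2 \<bullet> y2) \<cdot>\<^sub>v c1) = w \<cdot>\<^sub>v (c1 + D1 *\<^sub>v y1)"
    using car y1(1) y2(1) by (intro eq_vecI) (auto simp: w algebra_simps mult_mat_vec[of _ n1 n1])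
  finally have s: "s = (w \<cdot>\<^sub>v (c1 + D1 *\<^sub>v y1)) @\<^sub>v (c2 + D2 *\<^sub>v y2)" .
  have "vec_first s n1 = w \<cdot>\<^sub>v (c1 + D1 *\<^sub>v y1)" "vec_last s n2 = c2 + D2 *\<^sub>v y2"
    unfolding s using car y1(1) y2(1)
    by (auto simp: vec_first_def vec_last_def intro!: eq_vecI)
  then show "w \<cdot>\<^sub>v y1 = z1 \<cdot>\<^sub>v vec_first s n1" "y2 = z2 \<cdot>\<^sub>v vec_last s n2"
    using y1(2) y2(2) by (metis mult.commute smult_smult_assoc, metis)
  show "a1 * a2 + (b1 @\<^sub>v (a1 \<cdot>\<^sub>v b2)) \<bullet> ((w \<cdot>\<^sub>v y1) @\<^sub>v y2) = (a1 + b1 \<bullet> y1) * w"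
    using car wy y1(1) y2(1)
    by (simp add: scalar_prod_append[of _ n1 _ n2] w algebra_simps)
qed

lemma realizes_cascade:
  assumes 1: "realizes n1 a1 b1 c1 D1 f1" and 2: "realizes n2 a2 b2 c2 D2 f2"
  shows "realizes (n1 + n2) (a1 * a2) (b1 @\<^sub>v (a1 \<cdot>\<^sub>v b2)) ((a2 \<cdot>\<^sub>v c1) @\<^sub>v c2) (cascade_mat c1 D1 b2 D2)
    (\<lambda>z. f1 z * f2 z)"
proof -
  have iso: "isometric_system n1 a1 b1 c1 D1" "isometric_system n2 a2 b2 c2 D2"
    and C0: "D1 \<in> class_C0 n1" "D2 \<in> class_C0 n2"
    using 1 2 by (auto simp: realizes_def)
  then have car: "b1 \<in> carrier_vec n1" "c1 \<in> carrier_vec n1" "D1 \<in> carrier_mat n1 n1"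
    "b2 \<in> carrier_vec n2" "c2 \<in> carrier_vec n2" "D2 \<in> carrier_mat n2 n2"
    by (auto simp: isometric_system_def)
  let ?b = "b1 @\<^sub>v (a1 \<cdot>\<^sub>v b2)" and ?c = "(a2 \<cdot>\<^sub>v c1) @\<^sub>v c2" and ?D = "cascade_mat c1 D1 b2 D2"
  have isoD: "isometric_system (n1 + n2) (a1 * a2) ?b ?c ?D"
    by (rule isometric_system_cascade[OF iso])
  have "?D \<in> class_C0 (n1 + n2)"
    using class_C0_upper_triangular[OF C0 outer_carrier[OF car(2,4)]] contraction_isometric_system[OF isoD] car
    by (simp add: cascade_mat_def)
  moreover have "\<exists>y\<in>carrier_vec (n1 + n2). y = z \<cdot>\<^sub>v (?c + ?D *\<^sub>v y) \<and> f1 z * f2 z = a1 * a2 + ?b \<bullet> y"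
    if z: "z \<in> disc" for z
  proof -
    obtain y1 where y1: "y1 \<in> carrier_vec n1" "y1 = z \<cdot>\<^sub>v (c1 + D1 *\<^sub>v y1)" "f1 z = a1 + b1 \<bullet> y1"
      using 1 z unfolding realizes_def by blast
    obtain y2 where y2: "y2 \<in> carrier_vec n2" "y2 = z \<cdot>\<^sub>v (c2 + D2 *\<^sub>v y2)" "f2 z = a2 + b2 \<bullet> y2"
      using 2 z unfolding realizes_def by blast
    define y where "y = ((a2 + b2 \<bullet> y2) \<cdot>\<^sub>v y1) @\<^sub>v y2"
    have fp: "(a2 + b2 \<bullet> y2) \<cdot>\<^sub>v y1 = z \<cdot>\<^sub>v vec_first (?c + ?D *\<^sub>v y) n1"
      "y2 = z \<cdot>\<^sub>v vec_last (?c + ?D *\<^sub>v y) n2"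
      "a1 * a2 + ?b \<bullet> y = (a1 + b1 \<bullet> y1) * (a2 + b2 \<bullet> y2)"
      unfolding y_def by (rule cascade_fixpoint[OF car y1(1,2) y2(1,2) refl refl])+
    have y: "y \<in> carrier_vec (n1 + n2)"
      using y1 y2 by (simp add: y_def)
    have s: "?c + ?D *\<^sub>v y \<in> carrier_vec (n1 + n2)"
      using car y isoD by (auto simp: isometric_system_def)
    have "y = (z \<cdot>\<^sub>v vec_first (?c + ?D *\<^sub>v y) n1) @\<^sub>v (z \<cdot>\<^sub>v vec_last (?c + ?D *\<^sub>v y) n2)"
      using fp(1,2) by (metis y_def)
    also have "\<dots> = z \<cdot>\<^sub>v (vec_first (?c + ?D *\<^sub>v y) n1 @\<^sub>v vec_last (?c + ?D *\<^sub>v y) n2)"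
      by (intro eq_vecI) auto
    also have "\<dots> = z \<cdot>\<^sub>v (?c + ?D *\<^sub>v y)"
      using s by simp
    finally show ?thesis
      using y fp(3) y1(3) y2(3) by metis
  qed
  ultimately show ?thesis
    using isoD by (simp add: realizes_def)
qed

section \<open>Evaluation of the transfer function on the bidisc\<close>

lemma add_diff_cancel_vec:
  fixes u v :: "complex Matrix.vec"
  assumes "u \<in> carrier_vec n" "v \<in> carrier_vec n"
  shows "u + v - v = u"
  using assms by (intro eq_vecI) auto

text \<open>A kernel vector v would satisfy v = E (D v) with D v nonzero, so it would be strictly
  shorter than D v, although D does not increase norms.\<close>

lemma contraction_resolvent_det:
  assumes D: "contraction_mat n D" and E: "E \<in> carrier_mat n n"
    and strict: "\<And>v. v \<in> carrier_vec n \<Longrightarrow> v \<noteq> 0\<^sub>v n \<Longrightarrow> l2_norm_vec (E *\<^sub>v v) < l2_norm_vec v"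
  shows "det (1\<^sub>m n - E * D) \<noteq> 0"
proof
  have Dc: "D \<in> carrier_mat n n" using D by (simp add: contraction_mat_def)
  have M: "1\<^sub>m n - E * D \<in> carrier_mat n n" using E Dc by auto
  assume "det (1\<^sub>m n - E * D) = 0"
  then obtain v where v: "v \<in> carrier_vec n" "v \<noteq> 0\<^sub>v n" "(1\<^sub>m n - E * D) *\<^sub>v v = 0\<^sub>v n"
    using det_0_iff_vec_prod_zero[OF M] by blast
  have "(1\<^sub>m n - E * D) *\<^sub>v v = v - E *\<^sub>v (D *\<^sub>v v)"
    using E Dc v(1) by (simp add: minus_mult_distrib_mat_vec[of _ n n] assoc_mult_mat_vec[OF E Dc])
  moreover have EDv: "E *\<^sub>v (D *\<^sub>v v) \<in> carrier_vec n"
    using E Dc v(1) by auto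
  ultimately have zero: "v - E *\<^sub>v (D *\<^sub>v v) = 0\<^sub>v n" using v(3) by simp
  have eq: "v = E *\<^sub>v (D *\<^sub>v v)"
  proof (rule eq_vecI)
    fix i assume "i < dim_vec (E *\<^sub>v (D *\<^sub>v v))"
    then show "v $ i = (E *\<^sub>v (D *\<^sub>v v)) $ i"
      using arg_cong[OF zero, of "\<lambda>u. vec_index u i"] v(1) EDv E by auto
  qed (use v(1) EDv E in auto)
  have Dv: "D *\<^sub>v v \<in> carrier_vec n" using Dc v(1) by auto
  have "D *\<^sub>v v \<noteq> 0\<^sub>v n"
    using eq v(2) mult_mat_zero_vec[OF E] by auto
  then have "l2_norm_vec v < l2_norm_vec (D *\<^sub>v v)"
    using strict[OF Dv] eq by simp
  moreover have "l2_norm_vec (D *\<^sub>v v) \<le> l2_norm_vec v"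
    using D v(1) by (simp add: contraction_mat_def)
  ultimately show False by simp
qed

lemma E_mat_carrier: "E_mat n1 n2 z \<in> carrier_mat (n1 + n2) (n1 + n2)"
  unfolding E_mat_def by (intro four_block_carrier_mat) auto

lemma E_mat_mult_append:
  assumes "u \<in> carrier_vec n1" "v \<in> carrier_vec n2"
  shows "E_mat n1 n2 z *\<^sub>v (u @\<^sub>v v) = (fst z \<cdot>\<^sub>v u) @\<^sub>v (snd z \<cdot>\<^sub>v v)"
proof -
  have "(x \<cdot>\<^sub>m 1\<^sub>m n) *\<^sub>v w = x \<cdot>\<^sub>v w" if "w \<in> carrier_vec n" for x :: complex and n w
    using that by (intro eq_vecI) auto
  then show ?thesis
    unfolding E_mat_def
    using assms by (subst four_block_mat_mult_vec[of _ n1 n1 _ n2 _ n2]) (auto simp: zero_mult_mat_vec)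
qed

lemma l2_norm_E_mat_less:
  assumes z: "z \<in> bidisc" and v: "v \<in> carrier_vec (n1 + n2)" "v \<noteq> 0\<^sub>v (n1 + n2)"
  shows "l2_norm_vec (E_mat n1 n2 z *\<^sub>v v) < l2_norm_vec v"
proof -
  define u w where "u = vec_first v n1" and "w = vec_last v n2"
  have uw: "u \<in> carrier_vec n1" "w \<in> carrier_vec n2" "v = u @\<^sub>v w"
    using v by (auto simp: u_def w_def)
  define r where "r = max (cmod (fst z)) (cmod (snd z))"
  have r: "0 \<le> r" "r < 1" "cmod (fst z) \<le> r" "cmod (snd z) \<le> r"
    using z by (auto simp: r_def mem_Times_iff le_max_iff_disj)
  have "(l2_norm_vec (E_mat n1 n2 z *\<^sub>v v))\<^sup>2
      = (cmod (fst z) * l2_norm_vec u)\<^sup>2 + (cmod (snd z) * l2_norm_vec w)\<^sup>2"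
    using uw by (simp add: E_mat_mult_append l2_norm_vec_append l2_norm_vec_smult)
  also have "\<dots> \<le> (r * l2_norm_vec u)\<^sup>2 + (r * l2_norm_vec w)\<^sup>2"
    using r by (intro add_mono power_mono mult_right_mono) (auto simp: l2_norm_vec_nonneg)
  also have "\<dots> = (r * l2_norm_vec v)\<^sup>2"
    by (simp add: uw(3) l2_norm_vec_append power_mult_distrib algebra_simps)
  finally have "l2_norm_vec (E_mat n1 n2 z *\<^sub>v v) \<le> r * l2_norm_vec v"
    by (rule power2_le_imp_le) (simp add: r l2_norm_vec_nonneg)
  also have "\<dots> < 1 * l2_norm_vec v"
    using r(2) l2_norm_vec_eq_0_iff[OF v(1)] v(2) l2_norm_vec_nonneg[of v]
    by (intro mult_strict_right_mono) auto
  finally show ?thesis by simp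
qed

lemma split_block_colligation:
  assumes "B \<in> carrier_mat 1 n" "C \<in> carrier_mat n 1" "D \<in> carrier_mat n n"
  shows "split_block (colligation a B C D) 1 1 = (mat 1 1 (\<lambda>_. a), B, C, D)"
  using assms unfolding split_block_def colligation_def Let_def
  by (auto intro!: eq_matI)

text \<open>Any solution y of the state equation equals (I - E D)^{-1} E c, because I - E D is
  invertible. Afterwards a value of the transfer function is found by exhibiting such a y, without
  matrix inverses.\<close>

lemma transfer_function_eq:
  assumes BCD: "B \<in> carrier_mat 1 (n1 + n2)" "C \<in> carrier_mat (n1 + n2) 1"
      "D \<in> carrier_mat (n1 + n2) (n1 + n2)"
    and D: "contraction_mat (n1 + n2) D" and z: "z \<in> bidisc"
    and y: "y \<in> carrier_vec (n1 + n2)" "y = E_mat n1 n2 z *\<^sub>v (col C 0 + D *\<^sub>v y)"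
  shows "transfer_function n1 n2 (colligation a B C D) z = a + row B 0 \<bullet> y"
proof -
  define E M n where "E = E_mat n1 n2 z" and "M = 1\<^sub>m (n1 + n2) - E * D" and "n = n1 + n2"
  have E: "E \<in> carrier_mat n n" by (simp add: E_def n_def E_mat_carrier)
  note BCD = BCD[folded n_def] and y = y[folded n_def E_def]
  have M: "M \<in> carrier_mat n n" unfolding M_def n_def[symmetric] using E BCD by auto
  have "det M \<noteq> 0"
    unfolding M_def using D E l2_norm_E_mat_less[OF z]
    by (intro contraction_resolvent_det) (auto simp: E_def n_def)
  from det_non_zero_imp_unit[OF M this, of "()"] have "mat_inverse M \<noteq> None"
    using mat_inverse(1)[OF M, of "()"] by blast
  then obtain X where "mat_inverse M = Some X" by blast
  with mat_inverse(2)[OF M] have X: "the (mat_inverse M) = X" "X * M = 1\<^sub>m n" "X \<in> carrier_mat n n"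
    by auto
  let ?c = "col C 0"
  have c: "?c \<in> carrier_vec n" using BCD by auto
  have Ec: "E *\<^sub>v ?c \<in> carrier_vec n" and EDy: "E *\<^sub>v (D *\<^sub>v y) \<in> carrier_vec n" and Dy: "D *\<^sub>v y \<in> carrier_vec n"
    using E c BCD y by auto
  have "y = E *\<^sub>v ?c + E *\<^sub>v (D *\<^sub>v y)"
    using y(2) mult_add_distrib_mat_vec[OF E c Dy] by simp
  then have "y - E *\<^sub>v (D *\<^sub>v y) = E *\<^sub>v ?c"
    using Ec EDy by (metis add_diff_cancel_vec)
  moreover have "M *\<^sub>v y = y - E *\<^sub>v (D *\<^sub>v y)"
    unfolding M_def n_def[symmetric] using E BCD y(1)
    by (simp add: minus_mult_distrib_mat_vec[of _ n n] assoc_mult_mat_vec[OF E BCD(3)])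
  ultimately have "X *\<^sub>v (E *\<^sub>v ?c) = (X * M) *\<^sub>v y"
    using assoc_mult_mat_vec[OF X(3) M y(1)] by simp
  then have Xy: "X *\<^sub>v (E *\<^sub>v ?c) = y" using X(2) y(1) by simp
  have BX: "B * X \<in> carrier_mat 1 n" "B * X * E \<in> carrier_mat 1 n" using BCD X E by auto
  have "(B * X * E * C) $$ (0, 0) = ((B * X * E) *\<^sub>v ?c) $ 0"
    using BX BCD by simp
  also have "(B * X * E) *\<^sub>v ?c = B *\<^sub>v (X *\<^sub>v (E *\<^sub>v ?c))"
    using assoc_mult_mat_vec[OF BX(1) E c] assoc_mult_mat_vec[OF BCD(1) X(3) Ec] by simp
  finally have "(B * X * E * C) $$ (0, 0) = row B 0 \<bullet> y"
    using BCD Xy by simp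
  moreover have "(mat 1 1 (\<lambda>_. a) + B * X * E * C) $$ (0, 0) = a + (B * X * E * C) $$ (0, 0)"
    using BCD BX by simp
  ultimately show ?thesis
    unfolding transfer_function_def split_block_colligation[OF BCD, folded n_def] Let_def prod.case
    using X(1) by (simp add: E_def M_def)
qed

text \<open>The block operator is that of \<open>realizes_cascade\<close>, but E(z) attaches a
  separate variable to each state space, so the two factors are evaluated at different points. Both
  directions of the equivalence end here.\<close>

lemma transfer_function_cascade:
  assumes 1: "realizes n1 a1 b1 c1 D1 f1" and 2: "realizes n2 a2 b2 c2 D2 f2"
    and B: "B \<in> carrier_mat 1 (n1 + n2)" "row B 0 = b1 @\<^sub>v (a1 \<cdot>\<^sub>v b2)"
    and C: "C \<in> carrier_mat (n1 + n2) 1" "col C 0 = (a2 \<cdot>\<^sub>v c1) @\<^sub>v c2"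
    and z: "z \<in> bidisc"
  shows "transfer_function n1 n2 (colligation (a1 * a2) B C (cascade_mat c1 D1 b2 D2)) z = f1 (fst z) * f2 (snd z)"
proof -
  have iso: "isometric_system n1 a1 b1 c1 D1" "isometric_system n2 a2 b2 c2 D2"
    using 1 2 by (auto simp: realizes_def)
  then have car: "b1 \<in> carrier_vec n1" "c1 \<in> carrier_vec n1" "D1 \<in> carrier_mat n1 n1"
    "b2 \<in> carrier_vec n2" "c2 \<in> carrier_vec n2" "D2 \<in> carrier_mat n2 n2"
    by (auto simp: isometric_system_def)
  let ?D = "cascade_mat c1 D1 b2 D2"
  have isoD: "isometric_system (n1 + n2) (a1 * a2) (row B 0) (col C 0) ?D"
    unfolding B C by (rule isometric_system_cascade[OF iso])
  then have D: "?D \<in> carrier_mat (n1 + n2) (n1 + n2)" by (auto simp: isometric_system_def)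
  have "fst z \<in> disc" "snd z \<in> disc" using z by (auto simp: mem_Times_iff)
  with 1 2 obtain y1 y2 where
    y1: "y1 \<in> carrier_vec n1" "y1 = fst z \<cdot>\<^sub>v (c1 + D1 *\<^sub>v y1)" "f1 (fst z) = a1 + b1 \<bullet> y1" and
    y2: "y2 \<in> carrier_vec n2" "y2 = snd z \<cdot>\<^sub>v (c2 + D2 *\<^sub>v y2)" "f2 (snd z) = a2 + b2 \<bullet> y2"
    unfolding realizes_def by meson
  define y where "y = ((a2 + b2 \<bullet> y2) \<cdot>\<^sub>v y1) @\<^sub>v y2"
  let ?s = "col C 0 + ?D *\<^sub>v y"
  have fp: "(a2 + b2 \<bullet> y2) \<cdot>\<^sub>v y1 = fst z \<cdot>\<^sub>v vec_first ?s n1" "y2 = snd z \<cdot>\<^sub>v vec_last ?s n2"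
    "a1 * a2 + row B 0 \<bullet> y = (a1 + b1 \<bullet> y1) * (a2 + b2 \<bullet> y2)"
    unfolding y_def B C by (rule cascade_fixpoint[OF car y1(1,2) y2(1,2) refl refl])+
  have y: "y \<in> carrier_vec (n1 + n2)" using y1 y2 by (simp add: y_def)
  have s: "?s \<in> carrier_vec (n1 + n2)"
    using isoD mult_mat_vec_carrier[OF D y] by (simp add: isometric_system_def)
  have "E_mat n1 n2 z *\<^sub>v ?s = E_mat n1 n2 z *\<^sub>v (vec_first ?s n1 @\<^sub>v vec_last ?s n2)"
    using s by simp
  also have "\<dots> = (fst z \<cdot>\<^sub>v vec_first ?s n1) @\<^sub>v (snd z \<cdot>\<^sub>v vec_last ?s n2)"
    by (rule E_mat_mult_append) auto
  also have "\<dots> = y"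
    using fp(1,2) by (metis y_def)
  finally have "y = E_mat n1 n2 z *\<^sub>v ?s" by simp
  from transfer_function_eq[OF B(1) C(1) D contraction_isometric_system[OF isoD] z y this]
  show ?thesis using fp(3) y1(3) y2(3) by simp
qed

section \<open>Splitting a triangular colligation into two systems\<close>

text \<open>
  \<open>V\<close> maps \<open>0 \<oplus> \<complex>\<^bsup>n1\<^esup> \<oplus> 0\<close> isometrically into the \<open>(n1 + 1)\<close>-dimensional space \<open>\<complex> \<oplus> \<complex>\<^bsup>n1\<^esup> \<oplus> 0\<close>, so
  the vectors \<open>(a, c1)\<close> and \<open>(b2 \<bullet> e, D2 e)\<close>, both orthogonal to the image, are proportional.
  The scalar \<open>r\<close> is the norm of \<open>(a, c1)\<close>.
\<close>

lemma isometric_system_triangular_split: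
  assumes iso: "isometric_system (n1 + n2) a (b1 @\<^sub>v b2) (c1 @\<^sub>v c2) (four_block_mat D1 D2 (0\<^sub>m n2 n1) D3)"
    and car: "b1 \<in> carrier_vec n1" "c1 \<in> carrier_vec n1" "D1 \<in> carrier_mat n1 n1"
      "b2 \<in> carrier_vec n2" "c2 \<in> carrier_vec n2" "D2 \<in> carrier_mat n1 n2" "D3 \<in> carrier_mat n2 n2"
    and a: "a \<noteq> 0"
  obtains r where "r \<noteq> 0" "isometric_system n1 (a / r) b1 ((1 / r) \<cdot>\<^sub>v c1) D1"
    "isometric_system n2 r ((r / a) \<cdot>\<^sub>v b2) c2 D3" "D2 = outer ((1 / r) \<cdot>\<^sub>v c1) ((r / a) \<cdot>\<^sub>v b2)"
proof -
  let ?D = "four_block_mat D1 D2 (0\<^sub>m n2 n1) D3"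
  have out: "(b1 @\<^sub>v b2) \<bullet> (h1 @\<^sub>v h2) = b1 \<bullet> h1 + b2 \<bullet> h2"
    if "h1 \<in> carrier_vec n1" "h2 \<in> carrier_vec n2" for h1 h2
    using car that by (simp add: scalar_prod_append[of _ n1 _ n2])
  have state: "x \<cdot>\<^sub>v (c1 @\<^sub>v c2) + ?D *\<^sub>v (h1 @\<^sub>v h2)
      = (x \<cdot>\<^sub>v c1 + (D1 *\<^sub>v h1 + D2 *\<^sub>v h2)) @\<^sub>v (x \<cdot>\<^sub>v c2 + D3 *\<^sub>v h2)"
    if h: "h1 \<in> carrier_vec n1" "h2 \<in> carrier_vec n2" for x h1 h2
  proof -
    have "x \<cdot>\<^sub>v (c1 @\<^sub>v c2) = (x \<cdot>\<^sub>v c1) @\<^sub>v (x \<cdot>\<^sub>v c2)"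
      by (intro eq_vecI) auto
    moreover have "?D *\<^sub>v (h1 @\<^sub>v h2) = (D1 *\<^sub>v h1 + D2 *\<^sub>v h2) @\<^sub>v (D3 *\<^sub>v h2)"
      using car h by (subst four_block_mat_mult_vec[of _ n1 n1 _ n2 _ n2]) (auto simp: zero_mult_mat_vec)
    ultimately show ?thesis
      using car h by (simp add: append_vec_add[of _ n1 _ _ n2])
  qed
  \<comment> \<open>The isometry written out in blocks. Setting some of the arguments to 0 isolates
    the orthogonality relations between the block columns of V.\<close>
  have form: "(a * x + (b1 \<bullet> h1 + b2 \<bullet> h2)) * cnj (a * x' + (b1 \<bullet> h1' + b2 \<bullet> h2'))
      + ((x \<cdot>\<^sub>v c1 + (D1 *\<^sub>v h1 + D2 *\<^sub>v h2)) \<bullet>c (x' \<cdot>\<^sub>v c1 + (D1 *\<^sub>v h1' + D2 *\<^sub>v h2'))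
        + (x \<cdot>\<^sub>v c2 + D3 *\<^sub>v h2) \<bullet>c (x' \<cdot>\<^sub>v c2 + D3 *\<^sub>v h2'))
      = x * cnj x' + (h1 \<bullet>c h1' + h2 \<bullet>c h2')"
    if h: "h1 \<in> carrier_vec n1" "h2 \<in> carrier_vec n2" "h1' \<in> carrier_vec n1" "h2' \<in> carrier_vec n2"
    for x x' h1 h2 h1' h2'
  proof -
    have *: "h1 @\<^sub>v h2 \<in> carrier_vec (n1 + n2)" "h1' @\<^sub>v h2' \<in> carrier_vec (n1 + n2)"
      using h by auto
    have c: "x \<cdot>\<^sub>v c1 + (D1 *\<^sub>v h1 + D2 *\<^sub>v h2) \<in> carrier_vec n1" "x \<cdot>\<^sub>v c2 + D3 *\<^sub>v h2 \<in> carrier_vec n2"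
      "x' \<cdot>\<^sub>v c1 + (D1 *\<^sub>v h1' + D2 *\<^sub>v h2') \<in> carrier_vec n1" "x' \<cdot>\<^sub>v c2 + D3 *\<^sub>v h2' \<in> carrier_vec n2"
      using h car by auto
    show ?thesis
      using iso[unfolded isometric_system_def] *
      unfolding out[OF h(1,2), symmetric] out[OF h(3,4), symmetric]
        cscalar_prod_append[OF c, symmetric] cscalar_prod_append[OF h, symmetric]
        state[OF h(1,2), symmetric] state[OF h(3,4), symmetric]
      by blast
  qed
  note zeros [simp] = mult_mat_zero_vec[OF car(3)] mult_mat_zero_vec[OF car(6)] mult_mat_zero_vec[OF car(7)]
  have zc [simp]: "0 \<cdot>\<^sub>v c1 = 0\<^sub>v n1" "0 \<cdot>\<^sub>v c2 = 0\<^sub>v n2"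
    using car by (auto intro!: eq_vecI)
  have D1D1: "(b1 \<bullet> h) * cnj (b1 \<bullet> h') + (D1 *\<^sub>v h) \<bullet>c (D1 *\<^sub>v h') = h \<bullet>c h'"
    if "h \<in> carrier_vec n1" "h' \<in> carrier_vec n1" for h h'
    using form[of h "0\<^sub>v n2" h' "0\<^sub>v n2" 0 0] that car by simp
  have c1D1: "a * cnj (b1 \<bullet> h) + c1 \<bullet>c (D1 *\<^sub>v h) = 0" if "h \<in> carrier_vec n1" for h
    using form[of "0\<^sub>v n1" "0\<^sub>v n2" h "0\<^sub>v n2" 1 0] that car by simp
  have D2D1: "(b2 \<bullet> e) * cnj (b1 \<bullet> h) + (D2 *\<^sub>v e) \<bullet>c (D1 *\<^sub>v h) = 0"
    if "h \<in> carrier_vec n1" "e \<in> carrier_vec n2" for h e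
    using form[of "0\<^sub>v n1" e h "0\<^sub>v n2" 0 0] that car by simp
  \<comment> \<open>Here a \<noteq> 0 is essential: if D1 v = 0, orthogonality of (a, c1) and (b1
    \<bullet> v, D1 v) gives b1 \<bullet> v = 0, and then the isometric first block column sends v
    to 0.\<close>
  have detD1: "det D1 \<noteq> 0"
  proof
    assume "det D1 = 0"
    then obtain v where v: "v \<in> carrier_vec n1" "v \<noteq> 0\<^sub>v n1" "D1 *\<^sub>v v = 0\<^sub>v n1"
      using det_0_iff_vec_prod_zero[OF car(3)] by blast
    then have "b1 \<bullet> v = 0" using c1D1[OF v(1)] a car by simp
    then have "v \<bullet>c v = 0" using D1D1[OF v(1) v(1)] v by simp
    then show False using conjugate_square_eq_0_vec[OF v(1)] v(2) by simp
  qed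
  have D2: "a \<cdot>\<^sub>v (D2 *\<^sub>v e) = (b2 \<bullet> e) \<cdot>\<^sub>v c1" if e: "e \<in> carrier_vec n2" for e
  proof -
    have c: "D2 *\<^sub>v e \<in> carrier_vec n1" using car e by auto
    \<comment> \<open>The combination a (b2 \<bullet> e, D2 e) - (b2 \<bullet> e) (a, c1) has scalar
      coordinate 0 and vector coordinate \<open>x\<close>. Both of its terms are orthogonal to every
      (b1 \<bullet> h, D1 h), so \<open>x\<close> is orthogonal to the range of D1, which is the
      whole space.\<close>
    define x where "x = a \<cdot>\<^sub>v (D2 *\<^sub>v e) + (- (b2 \<bullet> e)) \<cdot>\<^sub>v c1"
    have x: "x \<in> carrier_vec n1" using car c by (simp add: x_def)
    have orth: "x \<bullet>c (D1 *\<^sub>v h) = 0" if h: "h \<in> carrier_vec n1" for h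
    proof -
      have "D1 *\<^sub>v h \<in> carrier_vec n1" using car h by auto
      then have "x \<bullet>c (D1 *\<^sub>v h) = a * ((D2 *\<^sub>v e) \<bullet>c (D1 *\<^sub>v h)) - (b2 \<bullet> e) * (c1 \<bullet>c (D1 *\<^sub>v h))"
        using car c by (simp add: x_def cscalar_prod_simps[of _ n1])
      also have "\<dots> = 0"
      proof -
        have "c1 \<bullet>c (D1 *\<^sub>v h) = - (a * cnj (b1 \<bullet> h))"
          "(D2 *\<^sub>v e) \<bullet>c (D1 *\<^sub>v h) = - ((b2 \<bullet> e) * cnj (b1 \<bullet> h))"
          using c1D1[OF h] D2D1[OF h e] by (simp_all add: add_eq_0_iff)
        then show ?thesis by simp
      qed
      finally show ?thesis .
    qed
    obtain X where X: "X \<in> carrier_mat n1 n1" "D1 * X = 1\<^sub>m n1"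
      using det_non_zero_imp_unit[OF car(3) detD1, of "()"] by (auto simp: Units_def ring_mat_def)
    have "x = D1 *\<^sub>v (X *\<^sub>v x)"
      using assoc_mult_mat_vec[OF car(3) X(1) x] X(2) x by simp
    moreover have "X *\<^sub>v x \<in> carrier_vec n1" using X x by auto
    ultimately have "x \<bullet>c x = 0" using orth by metis
    then have x0: "x = 0\<^sub>v n1" using conjugate_square_eq_0_vec[OF x] by simp
    show ?thesis
    proof (rule eq_vecI)
      fix i assume "i < dim_vec ((b2 \<bullet> e) \<cdot>\<^sub>v c1)"
      then show "(a \<cdot>\<^sub>v (D2 *\<^sub>v e)) $ i = ((b2 \<bullet> e) \<cdot>\<^sub>v c1) $ i"
        using arg_cong[OF x0, of "\<lambda>u. vec_index u i"] car c by (simp add: x_def)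
    qed (use car in auto)
  qed
  define \<rho> where "\<rho> = sqrt ((cmod a)\<^sup>2 + (l2_norm_vec c1)\<^sup>2)"
  define r where "r = complex_of_real \<rho>"
  have "\<rho> > 0" using a by (simp add: \<rho>_def add_pos_nonneg)
  then have r0: "r \<noteq> 0" and rr: "cnj r = r" by (auto simp: r_def)
  have "complex_of_real (\<rho>\<^sup>2) = a * cnj a + c1 \<bullet>c c1"
    by (simp add: \<rho>_def cscalar_prod_self complex_norm_square flip: of_real_power)
  then have r2: "r * r = a * cnj a + c1 \<bullet>c c1"
    by (simp add: r_def power2_eq_square)
  show ?thesis
  proof (rule that[OF r0])
    \<comment> \<open>The columns of (b1, D1) are orthonormal and orthogonal to (a, c1); division by
      \<open>r\<close> makes the latter a unit vector.\<close>
    show "isometric_system n1 (a / r) b1 ((1 / r) \<cdot>\<^sub>v c1) D1"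
      unfolding isometric_system_def
    proof (intro conjI allI ballI)
      fix x x' and h h' :: "complex Matrix.vec" assume h: "h \<in> carrier_vec n1" "h' \<in> carrier_vec n1"
      have Dh: "D1 *\<^sub>v h \<in> carrier_vec n1" "D1 *\<^sub>v h' \<in> carrier_vec n1" using car h by auto
      have s: "x \<cdot>\<^sub>v ((1 / r) \<cdot>\<^sub>v c1) = (x / r) \<cdot>\<^sub>v c1" for x using car by (auto intro!: eq_vecI)
      have c1D1': "cnj a * (b1 \<bullet> h) + (D1 *\<^sub>v h) \<bullet>c c1 = 0" if h: "h \<in> carrier_vec n1" for h
      proof -
        have "D1 *\<^sub>v h \<in> carrier_vec n1" using car h by auto
        from cscalar_prod_commute[OF car(2) this] c1D1[OF h]
        have "cnj (cnj a * (b1 \<bullet> h) + (D1 *\<^sub>v h) \<bullet>c c1) = 0" by simp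
        then show ?thesis by (simp only: complex_cnj_zero_iff)
      qed
      have "(a / r * x + b1 \<bullet> h) * cnj (a / r * x' + b1 \<bullet> h')
          + (x \<cdot>\<^sub>v ((1 / r) \<cdot>\<^sub>v c1) + D1 *\<^sub>v h) \<bullet>c (x' \<cdot>\<^sub>v ((1 / r) \<cdot>\<^sub>v c1) + D1 *\<^sub>v h')
        = (x / r) * (cnj x' / r) * (a * cnj a + c1 \<bullet>c c1)
          + (x / r) * (a * cnj (b1 \<bullet> h') + c1 \<bullet>c (D1 *\<^sub>v h'))
          + (cnj x' / r) * (cnj a * (b1 \<bullet> h) + (D1 *\<^sub>v h) \<bullet>c c1)
          + ((b1 \<bullet> h) * cnj (b1 \<bullet> h') + (D1 *\<^sub>v h) \<bullet>c (D1 *\<^sub>v h'))"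
        unfolding s using car Dh by (simp add: cscalar_prod_simps[of _ n1] rr algebra_simps add_divide_distrib)
      also have "\<dots> = x * cnj x' + h \<bullet>c h'"
        unfolding c1D1[OF h(2)] c1D1'[OF h(1)] D1D1[OF h] r2[symmetric] using r0 by simp
      finally show "(a / r * x + b1 \<bullet> h) * cnj (a / r * x' + b1 \<bullet> h')
          + (x \<cdot>\<^sub>v ((1 / r) \<cdot>\<^sub>v c1) + D1 *\<^sub>v h) \<bullet>c (x' \<cdot>\<^sub>v ((1 / r) \<cdot>\<^sub>v c1) + D1 *\<^sub>v h')
        = x * cnj x' + h \<bullet>c h'" .
    qed (use car in auto)
    show "isometric_system n2 r ((r / a) \<cdot>\<^sub>v b2) c2 D3"
      unfolding isometric_system_def
    proof (intro conjI allI ballI)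
      fix x x' and h h' :: "complex Matrix.vec" assume h: "h \<in> carrier_vec n2" "h' \<in> carrier_vec n2"
      \<comment> \<open>By proportionality the first two block rows of V send x, h to
        \<open>w x h\<close> times (a, c1), a vector of norm |r| |w x h|. They can therefore be
        collapsed into the single output \<open>r * w x h\<close>, which is where the feedthrough r
        and the row (r / a) b2 come from.\<close>
      define w where "w x h = x + (b2 \<bullet> h) / a" for x h
      have out: "r * x + ((r / a) \<cdot>\<^sub>v b2) \<bullet> h = r * w x h" "a * x + b2 \<bullet> h = a * w x h"
        if "h \<in> carrier_vec n2" for x h
        using that car a by (auto simp: w_def algebra_simps)
      have st: "x \<cdot>\<^sub>v c1 + D2 *\<^sub>v h = w x h \<cdot>\<^sub>v c1" if h: "h \<in> carrier_vec n2" for x h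
      proof (rule eq_vecI)
        fix i assume "i < dim_vec (w x h \<cdot>\<^sub>v c1)"
        then have "i < n1" using car by simp
        then show "(x \<cdot>\<^sub>v c1 + D2 *\<^sub>v h) $ i = (w x h \<cdot>\<^sub>v c1) $ i"
          using arg_cong[OF D2[OF h], of "\<lambda>u. vec_index u i"] car a by (simp add: w_def field_simps del: index_mult_mat_vec)
      qed (use car in auto)
      have D2h: "0\<^sub>v n1 + D2 *\<^sub>v h = D2 *\<^sub>v h" if "h \<in> carrier_vec n2" for h using car by auto
      have "a * w x h * cnj (a * w x' h') + ((w x h \<cdot>\<^sub>v c1) \<bullet>c (w x' h' \<cdot>\<^sub>v c1)
          + (x \<cdot>\<^sub>v c2 + D3 *\<^sub>v h) \<bullet>c (x' \<cdot>\<^sub>v c2 + D3 *\<^sub>v h')) = x * cnj x' + h \<bullet>c h'"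
        using form[of "0\<^sub>v n1" h "0\<^sub>v n1" h' x x'] h car by (simp add: out(2) st D2h)
      moreover have "a * w x h * cnj (a * w x' h') + (w x h \<cdot>\<^sub>v c1) \<bullet>c (w x' h' \<cdot>\<^sub>v c1)
          = (r * r) * (w x h * cnj (w x' h'))"
        unfolding r2 using car by (simp add: cscalar_prod_simps[of _ n1] algebra_simps)
      ultimately have "(r * r) * (w x h * cnj (w x' h'))
          + (x \<cdot>\<^sub>v c2 + D3 *\<^sub>v h) \<bullet>c (x' \<cdot>\<^sub>v c2 + D3 *\<^sub>v h') = x * cnj x' + h \<bullet>c h'"
        by (metis add.assoc)
      then show "(r * x + ((r / a) \<cdot>\<^sub>v b2) \<bullet> h) * cnj (r * x' + ((r / a) \<cdot>\<^sub>v b2) \<bullet> h')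
          + (x \<cdot>\<^sub>v c2 + D3 *\<^sub>v h) \<bullet>c (x' \<cdot>\<^sub>v c2 + D3 *\<^sub>v h') = x * cnj x' + h \<bullet>c h'"
        unfolding out(1)[OF h(1)] out(1)[OF h(2)] by (simp add: rr mult_ac)
    qed (use car in auto)
    show "D2 = outer ((1 / r) \<cdot>\<^sub>v c1) ((r / a) \<cdot>\<^sub>v b2)"
    proof (rule eq_matI)
      fix i j assume "i < dim_row (outer ((1 / r) \<cdot>\<^sub>v c1) ((r / a) \<cdot>\<^sub>v b2))"
        "j < dim_col (outer ((1 / r) \<cdot>\<^sub>v c1) ((r / a) \<cdot>\<^sub>v b2))"
      then have ij: "i < n1" "j < n2" using car by (auto simp: outer_def)
      have "(a \<cdot>\<^sub>v (D2 *\<^sub>v unit_vec n2 j)) $ i = ((b2 \<bullet> unit_vec n2 j) \<cdot>\<^sub>v c1) $ i"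
        using D2[of "unit_vec n2 j"] by simp
      then have "a * D2 $$ (i, j) = b2 $ j * c1 $ i" using ij car by simp
      then show "D2 $$ (i, j) = outer ((1 / r) \<cdot>\<^sub>v c1) ((r / a) \<cdot>\<^sub>v b2) $$ (i, j)"
        using ij car a r0 by (simp add: outer_def field_simps)
    qed (use car in \<open>auto simp: outer_def\<close>)
  qed
qed

section \<open>Isometric systems of class C_0. define rational inner functions\<close>

text \<open>If v = z D v then v = z^k D^k v for all k, and the right-hand side tends to 0 when |z|
  \<le> 1. In contrast to \<open>contraction_resolvent_det\<close> the circle is included, which
  rules out poles there.\<close>

lemma class_C0_resolvent_det:
  assumes D: "D \<in> class_C0 n" and z: "cmod z \<le> 1"
  shows "det (1\<^sub>m n - z \<cdot>\<^sub>m D) \<noteq> 0"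
proof
  note Dc = class_C0_carrier[OF D]
  assume "det (1\<^sub>m n - z \<cdot>\<^sub>m D) = 0"
  moreover have "1\<^sub>m n - z \<cdot>\<^sub>m D \<in> carrier_mat n n" using Dc by auto
  ultimately obtain v where v: "v \<in> carrier_vec n" "v \<noteq> 0\<^sub>v n" "(1\<^sub>m n - z \<cdot>\<^sub>m D) *\<^sub>v v = 0\<^sub>v n"
    using det_0_iff_vec_prod_zero by blast
  have zDv: "v = z \<cdot>\<^sub>v (D *\<^sub>v v)"
  proof (rule eq_vecI)
    fix i assume "i < dim_vec (z \<cdot>\<^sub>v (D *\<^sub>v v))"
    then have i: "i < n" using Dc by simp
    have "v - z \<cdot>\<^sub>v (D *\<^sub>v v) = 0\<^sub>v n"
      using v Dc by (simp add: minus_mult_distrib_mat_vec[of _ n n] smult_mat_mult_vec[of _ n n])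
    from arg_cong[OF this, of "\<lambda>u. vec_index u i"]
    show "v $ i = (z \<cdot>\<^sub>v (D *\<^sub>v v)) $ i" using i Dc v(1) by simp
  qed (use v Dc in auto)
  have "v = (z ^ k) \<cdot>\<^sub>v (D ^\<^sub>m k *\<^sub>v v)" for k
  proof (induction k)
    case 0
    then show ?case using Dc v(1) by (auto intro!: eq_vecI)
  next
    case (Suc k)
    have Dv: "D *\<^sub>v v \<in> carrier_vec n" using Dc v(1) by auto
    have "D ^\<^sub>m k *\<^sub>v v = z \<cdot>\<^sub>v (D ^\<^sub>m Suc k *\<^sub>v v)"
      using assoc_mult_mat_vec[OF pow_carrier_mat[OF Dc] Dc v(1), of k]
        mult_mat_vec[OF pow_carrier_mat[OF Dc] Dv, of k z] zDv by simp
    then show ?case using Suc by (simp add: smult_smult_assoc mult.commute)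
  qed
  then have "l2_norm_vec v = cmod z ^ k * l2_norm_vec (D ^\<^sub>m k *\<^sub>v v)" for k
    by (metis l2_norm_vec_smult norm_power)
  then have "l2_norm_vec v \<le> l2_norm_vec (D ^\<^sub>m k *\<^sub>v v)" for k
    using z by (metis l2_norm_vec_nonneg mult_left_le_one_le norm_ge_zero power_le_one zero_le_power)
  moreover have "(\<lambda>k. l2_norm_vec (D ^\<^sub>m k *\<^sub>v v)) \<longlonglongrightarrow> 0"
    using D v(1) by (simp add: class_C0_def)
  ultimately have "l2_norm_vec v \<le> 0"
    by (intro LIMSEQ_le_const) auto
  then show False
    using l2_norm_vec_eq_0_iff[OF v(1)] v(2) l2_norm_vec_nonneg[of v] by simp
qed

text \<open>Cramer's rule over the polynomial ring: \<open>q\<close> is the determinant of I - z D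
  with z an indeterminate, the \<open>P i\<close> are the entries of its adjugate applied to c, and
  evaluation at a point is a ring homomorphism.\<close>

lemma resolvent_polynomials:
  fixes c :: "complex Matrix.vec"
  assumes D: "D \<in> carrier_mat n n" and c: "c \<in> carrier_vec n"
  obtains P q where "\<And>z. poly q z = det (1\<^sub>m n - z \<cdot>\<^sub>m D)"
    "\<And>z. (1\<^sub>m n - z \<cdot>\<^sub>m D) *\<^sub>v vec n (\<lambda>i. poly (P i) z) = poly q z \<cdot>\<^sub>v c"
proof -
  define M where "M = mat n n (\<lambda>(i, j). (if i = j then 1 else 0) - [:0, D $$ (i, j):])"
  have M: "M \<in> carrier_mat n n" by (simp add: M_def)
  note adj = adj_mat[OF M]
  define w where "w = adj_mat M *\<^sub>v map_vec (\<lambda>x. [:x:]) c"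
  define P where "P i = w $ i" for i
  have c': "map_vec (\<lambda>x. [:x:]) c \<in> carrier_vec n" using c by simp
  have w: "w \<in> carrier_vec n" using adj(1) c' unfolding w_def by (rule mult_mat_vec_carrier)
  have Mw: "M *\<^sub>v w = det M \<cdot>\<^sub>v map_vec (\<lambda>x. [:x:]) c"
  proof -
    have "M *\<^sub>v w = (det M \<cdot>\<^sub>m 1\<^sub>m n) *\<^sub>v map_vec (\<lambda>x. [:x:]) c"
      unfolding w_def adj(2)[symmetric] by (rule assoc_mult_mat_vec[OF M adj(1) c', symmetric])
    then show ?thesis using c' by (simp add: smult_mat_mult_vec[of _ n n])
  qed
  show ?thesis
  proof (rule that)
    fix z :: complex
    have map: "map_mat (\<lambda>p. poly p z) M = 1\<^sub>m n - z \<cdot>\<^sub>m D"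
      using D by (intro eq_matI) (auto simp: M_def)
    show "poly (det M) z = det (1\<^sub>m n - z \<cdot>\<^sub>m D)"
      unfolding map[symmetric] by (rule comm_ring_hom.hom_det[OF poly_hom.comm_ring_hom_axioms, symmetric])
    have vec_P: "vec n (\<lambda>i. poly (P i) z) = map_vec (\<lambda>p. poly p z) w"
      using w by (intro eq_vecI) (auto simp: P_def)
    have "(1\<^sub>m n - z \<cdot>\<^sub>m D) *\<^sub>v vec n (\<lambda>i. poly (P i) z) = map_vec (\<lambda>p. poly p z) (M *\<^sub>v w)"
      unfolding vec_P map[symmetric]
      by (rule semiring_hom.mult_mat_vec_hom[OF poly_hom.semiring_hom_axioms M w, symmetric])
    also have "\<dots> = poly (det M) z \<cdot>\<^sub>v c"
      unfolding Mw using c by (intro eq_vecI) auto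
    finally show "(1\<^sub>m n - z \<cdot>\<^sub>m D) *\<^sub>v vec n (\<lambda>i. poly (P i) z) = poly (det M) z \<cdot>\<^sub>v c" .
  qed
qed

lemma radial_limit_quotient:
  assumes "\<And>z. z \<in> disc \<Longrightarrow> f z = poly p z / poly q z" and q: "poly q (cis t) \<noteq> 0"
  shows "((\<lambda>r. cmod (f (of_real r * cis t))) \<longlongrightarrow> cmod (poly p (cis t) / poly q (cis t))) (at_left (1 :: real))"
proof -
  have "isCont (\<lambda>r::real. of_real r * cis t) 1"
    by (intro continuous_intros)
  then have radius: "((\<lambda>r. of_real r * cis t) \<longlongrightarrow> cis t) (at_left (1 :: real))"
    using filterlim_at_split[of "\<lambda>r::real. of_real r * cis t" "nhds (cis t)" 1] by (simp add: isCont_def)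
  have cont: "isCont (\<lambda>z. cmod (poly p z / poly q z)) (cis t)"
    using q by (intro continuous_intros)
  note lim = isCont_tendsto_compose[OF cont radius]
  have "eventually (\<lambda>r::real. 0 < r \<and> r < 1) (at_left 1)"
    using eventually_at_left_real[of 0 1] by (auto elim: eventually_mono)
  then have "eventually (\<lambda>r. cmod (poly p (of_real r * cis t) / poly q (of_real r * cis t))
      = cmod (f (of_real r * cis t))) (at_left (1 :: real))"
    by eventually_elim (simp add: assms(1) norm_mult)
  with lim show ?thesis by (rule Lim_transform_eventually)
qed

text \<open>Since \<open>q\<close> has no zero in the closed disc, the norm identity holds there
  too, and |f| = 1 at every point of the circle.\<close>

lemma isometric_system_rational_inner:
  assumes iso: "isometric_system n a b c D" and C0: "D \<in> class_C0 n"
  obtains f where "realizes n a b c D f" "rational_inner_disc f"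
proof -
  have car: "b \<in> carrier_vec n" "c \<in> carrier_vec n" "D \<in> carrier_mat n n"
    using iso by (auto simp: isometric_system_def)
  obtain P q where q: "\<And>z. poly q z = det (1\<^sub>m n - z \<cdot>\<^sub>m D)"
    and P: "\<And>z. (1\<^sub>m n - z \<cdot>\<^sub>m D) *\<^sub>v vec n (\<lambda>i. poly (P i) z) = poly q z \<cdot>\<^sub>v c"
    using resolvent_polynomials[OF car(3,2)] by metis
  have q0: "poly q z \<noteq> 0" if "cmod z \<le> 1" for z
    unfolding q by (rule class_C0_resolvent_det[OF C0 that])
  \<comment> \<open>\<open>x z\<close> is (I - z D)^{-1} c, the state before the delay; the state y
    of \<open>realizes\<close> is z times it.\<close>
  define x where "x z = vec n (\<lambda>i. poly (P i) z / poly q z)" for z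
  define f where "f z = a + b \<bullet> (z \<cdot>\<^sub>v x z)" for z
  have x: "x z \<in> carrier_vec n" for z by (simp add: x_def)
  have fix_x: "x z = c + D *\<^sub>v (z \<cdot>\<^sub>v x z)" if z: "cmod z \<le> 1" for z
  proof (rule eq_vecI)
    let ?v = "vec n (\<lambda>i. poly (P i) z)"
    have v: "?v \<in> carrier_vec n" by simp
    have xv: "z \<cdot>\<^sub>v x z = (z / poly q z) \<cdot>\<^sub>v ?v" "x z = (1 / poly q z) \<cdot>\<^sub>v ?v"
      by (auto simp: x_def intro!: eq_vecI)
    fix i assume "i < dim_vec (c + D *\<^sub>v (z \<cdot>\<^sub>v x z))"
    then have i: "i < n" using car by simp
    have "?v - z \<cdot>\<^sub>v (D *\<^sub>v ?v) = poly q z \<cdot>\<^sub>v c"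
      using P[of z] car by (simp add: minus_mult_distrib_mat_vec[of _ n n] smult_mat_mult_vec[of _ n n])
    from arg_cong[OF this, of "\<lambda>u. vec_index u i"]
    have "?v $ i = z * (D *\<^sub>v ?v) $ i + poly q z * c $ i"
      using i car by (simp add: algebra_simps del: index_vec index_mult_mat_vec)
    moreover have "(D *\<^sub>v (z \<cdot>\<^sub>v x z)) $ i = z / poly q z * (D *\<^sub>v ?v) $ i"
      unfolding xv mult_mat_vec[OF car(3) v] using i car by simp
    moreover have "x z $ i = ?v $ i / poly q z" using i by (simp add: x_def)
    ultimately show "x z $ i = (c + D *\<^sub>v (z \<cdot>\<^sub>v x z)) $ i"
      using i car q0[OF z] by (simp add: add_divide_distrib del: index_vec index_mult_mat_vec)
  qed (use car x in auto)
  \<comment> \<open>Energy balance with input 1 and old state z x(z): by \<open>fix_x\<close> the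
    new state is x(z), so |f|^2 + |x|^2 = 1 + |z|^2 |x|^2.\<close>
  have norm: "(cmod (f z))\<^sup>2 + (1 - (cmod z)\<^sup>2) * (l2_norm_vec (x z))\<^sup>2 = 1" if z: "cmod z \<le> 1" for z
  proof -
    have "1 \<cdot>\<^sub>v c = c" using car by (auto intro!: eq_vecI)
    moreover have "z \<cdot>\<^sub>v x z \<in> carrier_vec n" using x by auto
    ultimately show ?thesis
      using isometric_system_norm[OF iso, of "z \<cdot>\<^sub>v x z" 1] fix_x[OF z]
      by (simp add: f_def l2_norm_vec_smult power_mult_distrib algebra_simps)
  qed
  have realizes: "realizes n a b c D f"
    unfolding realizes_def
  proof (intro conjI ballI)
    fix z :: complex assume "z \<in> disc"
    then have z: "cmod z \<le> 1" by simp
    show "\<exists>y\<in>carrier_vec n. y = z \<cdot>\<^sub>v (c + D *\<^sub>v y) \<and> f z = a + b \<bullet> y"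
      using x fix_x[OF z] by (intro bexI[of _ "z \<cdot>\<^sub>v x z"]) (auto simp: f_def)
  qed (use iso C0 in auto)
  define p where "p = [:a:] * q + [:0, 1:] * (\<Sum>i<n. [:b $ i:] * P i)"
  have fpq: "f z = poly p z / poly q z" if z: "cmod z \<le> 1" for z
  proof -
    have "b \<bullet> (z \<cdot>\<^sub>v x z) = (\<Sum>i<n. b $ i * (z * (poly (P i) z / poly q z)))"
      using car by (simp add: x_def scalar_prod_def lessThan_atLeast0)
    also have "\<dots> = z * (\<Sum>i<n. b $ i * poly (P i) z) / poly q z"
      by (simp add: sum_distrib_left sum_divide_distrib mult_ac)
    finally show ?thesis
      using q0[OF z] by (simp add: f_def p_def poly_sum add_divide_distrib)
  qed
  have le1: "cmod (f z) \<le> 1" if z: "cmod z \<le> 1" for z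
  proof -
    have "0 \<le> (1 - (cmod z)\<^sup>2) * (l2_norm_vec (x z))\<^sup>2"
      using z by (intro mult_nonneg_nonneg) (auto simp: power_le_one)
    then have "(cmod (f z))\<^sup>2 \<le> 1\<^sup>2" using norm[OF z] by simp
    then show ?thesis by (rule power2_le_imp_le) simp
  qed
  have "(\<lambda>z. poly p z / poly q z) holomorphic_on disc"
    by (intro holomorphic_intros) (use q0 in auto)
  then have "f holomorphic_on disc"
    by (rule holomorphic_transform) (auto simp: fpq)
  then have "f \<in> schur_disc"
    using le1 by (auto simp: schur_disc_def)
  moreover have "((\<lambda>r. cmod (f (of_real r * cis t))) \<longlongrightarrow> 1) (at_left (1 :: real))" for t
  proof -
    have q1: "poly q (cis t) \<noteq> 0" by (rule q0) simp
    have "((\<lambda>r. cmod (f (of_real r * cis t))) \<longlongrightarrow> cmod (poly p (cis t) / poly q (cis t))) (at_left (1 :: real))"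
      by (rule radial_limit_quotient) (use q1 fpq in auto)
    moreover have "cmod (poly p (cis t) / poly q (cis t)) = 1"
      using power2_eq_imp_eq[of "cmod (f (cis t))" 1] norm[of "cis t"] fpq[of "cis t"] by simp
    ultimately show ?thesis by (simp only:)
  qed
  moreover have "rational_on_disc f"
    unfolding rational_on_disc_def
    using q0[of 0] fpq by (intro exI[of _ p] exI[of _ q]) auto
  ultimately have "rational_inner_disc f"
    by (simp add: rational_inner_disc_def inner_disc_def)
  with realizes show ?thesis by (rule that)
qed

section \<open>Finite Blaschke products have realizations\<close>

text \<open>Without states the colligation is the 1 by 1 unitary matrix c. This is the base of the
  induction on zeros.\<close>

lemma realizes_const:
  assumes "cmod c = 1"
  shows "realizes 0 c (0\<^sub>v 0) (0\<^sub>v 0) (0\<^sub>m 0 0) (\<lambda>_. c)"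
proof -
  have cc: "c * cnj c = 1" using assms by (simp add: complex_norm_square[symmetric])
  have v0: "v = 0\<^sub>v 0" if "v \<in> carrier_vec 0" for v :: "complex Matrix.vec"
    using that by auto
  have "(c * x) * cnj (c * x') = x * cnj x'" for x x'
    using cc by (metis (no_types, lifting) complex_cnj_mult mult.assoc mult.left_commute mult_1)
  then have "isometric_system 0 c (0\<^sub>v 0) (0\<^sub>v 0) (0\<^sub>m 0 0)"
    by (auto simp: isometric_system_def scalar_prod_def)
  moreover have "0\<^sub>m 0 0 \<in> class_C0 0"
    by (auto simp: class_C0_def contraction_mat_def l2_norm_vec_def)
  ultimately show ?thesis
    by (auto simp: realizes_def scalar_prod_def intro!: bexI[of _ "0\<^sub>v 0"])
qed

text \<open>The colligation is the unitary matrix with rows (-\<alpha>, s) and (s, cnj \<alpha>),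
  where s is the defect of \<alpha>. Its transfer function is -\<alpha> + s^2 z / (1 - cnj \<alpha>
  z).\<close>

lemma realizes_blaschke:
  assumes \<alpha>: "cmod \<alpha> < 1"
  defines "s \<equiv> complex_of_real (sqrt (1 - (cmod \<alpha>)\<^sup>2))"
  shows "realizes 1 (- \<alpha>) (vec 1 (\<lambda>_. s)) (vec 1 (\<lambda>_. s)) (mat 1 1 (\<lambda>_. cnj \<alpha>))
    (\<lambda>z. (z - \<alpha>) / (1 - cnj \<alpha> * z))"
proof -
  let ?b = "vec 1 (\<lambda>_. s)" and ?D = "mat 1 1 (\<lambda>_. cnj \<alpha>)"
  have "(cmod \<alpha>)\<^sup>2 \<le> 1" using \<alpha> by (simp add: power_le_one)
  then have ss: "s * s = 1 - \<alpha> * cnj \<alpha>" and sr: "cnj s = s"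
    by (simp_all add: s_def complex_norm_square flip: of_real_mult of_real_power)
  have D: "?D *\<^sub>v v = cnj \<alpha> \<cdot>\<^sub>v v" if "v \<in> carrier_vec 1" for v
    using that by (intro eq_vecI) (auto simp: scalar_prod_def)
  have iso: "isometric_system 1 (- \<alpha>) ?b ?b ?D"
    unfolding isometric_system_def
  proof (intro conjI allI ballI)
    fix x x' and h h' :: "complex Matrix.vec" assume h: "h \<in> carrier_vec 1" "h' \<in> carrier_vec 1"
    have eq: "(- \<alpha> * x + s * y) * cnj (- \<alpha> * x' + s * y') + (x * s + cnj \<alpha> * y) * cnj (x' * s + cnj \<alpha> * y')
        = x * cnj x' + y * cnj y'" for y y'
    proof -
      have "(- \<alpha> * x + s * y) * cnj (- \<alpha> * x' + s * y') + (x * s + cnj \<alpha> * y) * cnj (x' * s + cnj \<alpha> * y')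
        = (s * s + \<alpha> * cnj \<alpha>) * (x * cnj x' + y * cnj y')"
        by (simp add: sr algebra_simps)
      then show ?thesis by (simp add: ss)
    qed
    show "(- \<alpha> * x + ?b \<bullet> h) * cnj (- \<alpha> * x' + ?b \<bullet> h') + (x \<cdot>\<^sub>v ?b + ?D *\<^sub>v h) \<bullet>c (x' \<cdot>\<^sub>v ?b + ?D *\<^sub>v h')
        = x * cnj x' + h \<bullet>c h'"
      using h eq[of "h $ 0" "h' $ 0"] by (simp add: D cscalar_prod_eq_sum[of _ 1] scalar_prod_def)
  qed auto
  have "?D \<in> class_C0 1"
  proof -
    have "(\<lambda>m. l2_norm_vec ((?D ^\<^sub>m m) *\<^sub>v v)) \<longlonglongrightarrow> 0" if v: "v \<in> carrier_vec 1" for v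
    proof -
      have "?D ^\<^sub>m m *\<^sub>v v = (cnj \<alpha> ^ m) \<cdot>\<^sub>v v" for m
        using v
      proof (induction m arbitrary: v)
        case 0
        then show ?case by (auto intro!: eq_vecI)
      next
        case (Suc m)
        have "?D ^\<^sub>m Suc m *\<^sub>v v = ?D ^\<^sub>m m *\<^sub>v (?D *\<^sub>v v)"
          using assoc_mult_mat_vec[OF pow_carrier_mat _ Suc.prems, of ?D 1 ?D m] by simp
        also have "\<dots> = (cnj \<alpha> ^ m) \<cdot>\<^sub>v (cnj \<alpha> \<cdot>\<^sub>v v)"
          unfolding D[OF Suc.prems] by (rule Suc.IH) (use Suc.prems in simp)
        finally show ?case by (simp add: smult_smult_assoc mult.commute)
      qed
      then have "l2_norm_vec (?D ^\<^sub>m m *\<^sub>v v) = cmod \<alpha> ^ m * l2_norm_vec v" for m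
        by (simp add: l2_norm_vec_smult norm_power)
      moreover have "(\<lambda>m. cmod \<alpha> ^ m * l2_norm_vec v) \<longlonglongrightarrow> 0"
        using \<alpha> by (intro tendsto_mult_left_zero LIMSEQ_power_zero) auto
      ultimately show ?thesis by simp
    qed
    with contraction_isometric_system[OF iso] show ?thesis by (simp add: class_C0_def)
  qed
  moreover have "\<exists>y\<in>carrier_vec 1. y = z \<cdot>\<^sub>v (?b + ?D *\<^sub>v y) \<and> (z - \<alpha>) / (1 - cnj \<alpha> * z) = - \<alpha> + ?b \<bullet> y"
    if z: "z \<in> disc" for z
  proof -
    have "cmod (cnj \<alpha> * z) < 1"
      using \<alpha> z mult_strict_mono'[of "cmod \<alpha>" 1 "cmod z" 1] by (simp add: norm_mult)
    then have nz: "1 - cnj \<alpha> * z \<noteq> 0" by auto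
    \<comment> \<open>The solution of the scalar state equation e = z (s + cnj \<alpha> e).\<close>
    define e where "e = z * s / (1 - cnj \<alpha> * z)"
    define y where "y = vec 1 (\<lambda>_. e)"
    have y: "y \<in> carrier_vec 1" by (simp add: y_def)
    have e: "z * (s + cnj \<alpha> * e) = e"
      unfolding e_def using nz by (simp add: field_simps)
    have "z \<cdot>\<^sub>v (?b + cnj \<alpha> \<cdot>\<^sub>v y) = vec 1 (\<lambda>_. z * (s + cnj \<alpha> * e))"
      by (intro eq_vecI) (auto simp: y_def)
    then have "y = z \<cdot>\<^sub>v (?b + ?D *\<^sub>v y)"
      unfolding D[OF y] e by (simp only: y_def)
    moreover have "- \<alpha> + ?b \<bullet> y = - \<alpha> + (s * s) * z / (1 - cnj \<alpha> * z)"
      by (simp add: y_def e_def scalar_prod_def)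
    moreover have "\<dots> = (z - \<alpha>) / (1 - cnj \<alpha> * z)"
      unfolding ss using nz by (simp add: field_simps)
    ultimately show ?thesis using y by auto
  qed
  ultimately show ?thesis using iso by (simp add: realizes_def)
qed

lemma realizes_cong:
  assumes "realizes n a b c D f" "\<And>z. z \<in> disc \<Longrightarrow> f z = g z"
  shows "realizes n a b c D g"
  using assms by (auto simp: realizes_def)

text \<open>The maximum principle applies to p / q and to q / p, since the boundary condition
  excludes zeros of p on the circle as well. Hence the modulus is 1 throughout the disc, and an
  interior maximum forces a constant.\<close>

lemma unimodular_quotient_const:
  fixes p q :: "complex poly"
  assumes q: "\<And>z. cmod z \<le> 1 \<Longrightarrow> poly q z \<noteq> 0" and p: "\<And>z. cmod z < 1 \<Longrightarrow> poly p z \<noteq> 0"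
    and eq: "\<And>z. cmod z = 1 \<Longrightarrow> cmod (poly p z) = cmod (poly q z)"
  obtains c where "cmod c = 1" "\<And>z. z \<in> disc \<Longrightarrow> poly p z / poly q z = c"
proof -
  have p': "poly p z \<noteq> 0" if "cmod z \<le> 1" for z
    using p[of z] eq[of z] q[of z] that by (cases "cmod z = 1") auto
  have bound: "cmod (poly u z / poly v z) \<le> 1"
    if v: "\<And>z. cmod z \<le> 1 \<Longrightarrow> poly v z \<noteq> 0"
      and uv: "\<And>z. cmod z = 1 \<Longrightarrow> cmod (poly u z) = cmod (poly v z)" and z: "z \<in> disc"
    for u v :: "complex poly" and z
  proof (rule maximum_modulus_frontier[of "\<lambda>z. poly u z / poly v z" disc])
    show "(\<lambda>z. poly u z / poly v z) holomorphic_on interior disc"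
      by (intro holomorphic_intros) (use v in auto)
    show "continuous_on (closure disc) (\<lambda>z. poly u z / poly v z)"
      by (intro continuous_intros) (use v in auto)
    show "cmod (poly u w / poly v w) \<le> 1" if "w \<in> frontier disc" for w
      using that uv[of w] v[of w] by (simp add: norm_divide)
  qed (use z in auto)
  have unim: "cmod (poly p z / poly q z) = 1" if z: "z \<in> disc" for z
  proof -
    have "cmod (poly p z) \<le> cmod (poly q z)" "cmod (poly q z) \<le> cmod (poly p z)"
      using bound[of q p z] bound[of p q z] q[of z] p'[of z] eq q p' z
      by (simp_all add: norm_divide divide_le_eq_1)
    then show ?thesis using q[of z] z by (simp add: norm_divide)
  qed
  have "(\<lambda>z. poly p z / poly q z) constant_on disc"
    by (rule maximum_modulus_principle[of _ disc disc 0])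
      (use q unim in \<open>auto intro!: holomorphic_intros\<close>)
  then obtain c where c: "\<And>z. z \<in> disc \<Longrightarrow> poly p z / poly q z = c"
    by (auto simp: constant_on_def)
  moreover have "cmod c = 1" using c[of 0] unim[of 0] by simp
  ultimately show ?thesis using that by blast
qed

text \<open>Keeps the boundary hypothesis of the next induction intact when a factor vanishing in
  the disc is exchanged for one that does not.\<close>

lemma cmod_blaschke_denominator:
  assumes "cmod z = 1"
  shows "cmod (1 - cnj \<alpha> * z) = cmod (z - \<alpha>)"
proof -
  have "z * cnj z = 1" using assms by (simp add: complex_norm_square[symmetric])
  then have "1 - cnj \<alpha> * z = z * cnj (z - \<alpha>)" by (simp add: algebra_simps)
  then show ?thesis using assms by (metis complex_mod_cnj mult_1 norm_mult)
qed

text \<open>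
  Zeros \<open>\<alpha>\<close> of \<open>p\<close> in the disc are split off one at a time as Blaschke factors, with \<open>z - \<alpha>\<close>
  replaced by \<open>1 - cnj \<alpha> z\<close> in the remaining numerator; \<open>p0\<close> collects the linear factors already
  known to have no zeros in the disc.
\<close>

lemma unimodular_quotient_realizes:
  fixes p p0 q :: "complex poly"
  assumes "\<And>z. cmod z \<le> 1 \<Longrightarrow> poly q z \<noteq> 0" "\<And>z. cmod z < 1 \<Longrightarrow> poly p0 z \<noteq> 0"
    and "\<And>z. cmod z = 1 \<Longrightarrow> cmod (poly (p * p0) z) = cmod (poly q z)"
  shows "\<exists>n a b c D. realizes n a b c D (\<lambda>z. poly (p * p0) z / poly q z)"
  using assms
proof (induction "degree p" arbitrary: p p0)
  case 0
  then obtain k where k: "p = [:k:]" using degree_eq_zeroE by metis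
  \<comment> \<open>At the boundary point 1 the numerator has the modulus of \<open>q\<close>, so
    the constant p cannot be 0.\<close>
  have "poly (p * p0) 1 \<noteq> 0" using 0(2)[of 1] 0(4)[of 1] by auto
  then have "k \<noteq> 0" by (auto simp: k)
  then have "poly (p * p0) z \<noteq> 0" if "cmod z < 1" for z using 0(3)[OF that] by (simp add: k)
  then obtain c where c: "cmod c = 1" "\<And>z. z \<in> disc \<Longrightarrow> poly (p * p0) z / poly q z = c"
    using unimodular_quotient_const[of q "p * p0"] 0(2,4) by blast
  have "realizes 0 c (0\<^sub>v 0) (0\<^sub>v 0) (0\<^sub>m 0 0) (\<lambda>z. poly (p * p0) z / poly q z)"
    by (rule realizes_cong[OF realizes_const[OF c(1)]]) (rule c(2)[symmetric])
  then show ?case by blast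
next
  case (Suc d)
  then have "\<not> constant (poly p)" by (simp add: constant_degree)
  then obtain \<alpha> where "poly p \<alpha> = 0" using fundamental_theorem_of_algebra by blast
  then obtain p1 where p: "p = [:- \<alpha>, 1:] * p1" by (auto simp: poly_eq_0_iff_dvd dvd_def)
  have "p1 \<noteq> 0" using Suc(2) p by auto
  then have d: "d = degree p1" using Suc(2) p by (subst (asm) p, subst (asm) degree_mult_eq) auto
  show ?case
  proof (cases "cmod \<alpha> < 1")
    case False
    then have nz: "poly ([:- \<alpha>, 1:] * p0) z \<noteq> 0" if "cmod z < 1" for z
      using Suc(4)[OF that] that by auto
    have eq: "p1 * ([:- \<alpha>, 1:] * p0) = p * p0"
      unfolding p by (simp only: ac_simps)
    show ?thesis
      by (rule Suc(1)[OF d, of "[:- \<alpha>, 1:] * p0", unfolded eq, OF Suc(3) nz Suc(5)])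
  next
    case True
    define g where "g z = poly (p1 * ([:1, - cnj \<alpha>:] * p0)) z / poly q z" for z
    have nz1: "1 - cnj \<alpha> * z \<noteq> 0" if "cmod z < 1" for z
    proof -
      have "cmod (cnj \<alpha> * z) < 1"
        using True that mult_strict_mono'[of "cmod \<alpha>" 1 "cmod z" 1] by (simp add: norm_mult)
      then show ?thesis by auto
    qed
    have "\<exists>n a b c D. realizes n a b c D g"
      unfolding g_def
    proof (rule Suc(1)[OF d Suc(3)])
      show "poly ([:1, - cnj \<alpha>:] * p0) z \<noteq> 0" if "cmod z < 1" for z
        using Suc(4)[OF that] nz1[OF that] by (simp add: mult.commute)
      show "cmod (poly (p1 * ([:1, - cnj \<alpha>:] * p0)) z) = cmod (poly q z)" if "cmod z = 1" for z
      proof -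
        have "poly (p1 * ([:1, - cnj \<alpha>:] * p0)) z = poly p1 z * ((1 - cnj \<alpha> * z) * poly p0 z)"
          by (simp only: poly_mult) (simp add: mult_ac)
        moreover have "poly (p * p0) z = poly p1 z * ((z - \<alpha>) * poly p0 z)"
          unfolding p by (simp only: poly_mult) (simp add: mult_ac)
        ultimately show ?thesis
          using Suc(5)[OF that] cmod_blaschke_denominator[OF that, of \<alpha>] by (simp only: norm_mult)
      qed
    qed
    then obtain n a b c D where "realizes n a b c D g" by blast
    note cascade = realizes_cascade[OF realizes_blaschke[OF True] this]
    have quotient: "(z - \<alpha>) / (1 - cnj \<alpha> * z) * g z = poly (p * p0) z / poly q z" if "z \<in> disc" for z
    proof -
      have g: "g z = (1 - cnj \<alpha> * z) * (poly p1 z * poly p0 z / poly q z)"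
        by (simp add: g_def mult_ac) (simp add: algebra_simps)
      have pp0: "poly (p * p0) z = (z - \<alpha>) * (poly p1 z * poly p0 z)"
        by (simp add: p algebra_simps)
      show ?thesis unfolding g pp0 using nz1[of z] that by simp
    qed
    show ?thesis
      using realizes_cong[OF cascade quotient] by blast
  qed
qed

section \<open>From rational inner functions on the disc to realizations\<close>

text \<open>The set where f is nonzero is open and contained in the finite set F, hence
  empty.\<close>

lemma holomorphic_eq_zero_cofinite:
  assumes f: "f holomorphic_on disc" and F: "finite F" and zero: "\<And>z. z \<in> disc - F \<Longrightarrow> f z = 0"
    and z: "z \<in> disc"
  shows "f z = 0"
proof (rule ccontr)
  assume nz: "f z \<noteq> 0"
  have "open {w \<in> disc. f w \<in> - {0}}"
    using continuous_open_preimage[OF holomorphic_on_imp_continuous_on[OF f] open_ball open_Compl[OF closed_singleton[of 0]]]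
    by (simp add: vimage_def Int_def)
  moreover have "{w \<in> disc. f w \<in> - {0}} \<subseteq> F" using zero by auto
  ultimately have "open {w \<in> disc. f w \<in> - {0}}" "finite {w \<in> disc. f w \<in> - {0}}"
    using F finite_subset by auto
  moreover have "z \<in> {w \<in> disc. f w \<in> - {0}}" using z nz by simp
  ultimately show False
    using finite_imp_not_open by blast
qed

text \<open>\<open>rational_on_disc\<close> says nothing about f at zeros of the denominator, so the
  relation is put in the form f q = p, which extends to those points. A denominator of least degree
  then has no zero in common with p, anywhere in the plane: the corresponding linear factor could be
  cancelled.\<close>

lemma rational_on_disc_reduced:
  assumes f: "f holomorphic_on disc" and "rational_on_disc f"
  obtains p q where "\<And>z. z \<in> disc \<Longrightarrow> f z * poly q z = poly p z" "\<And>z. poly q z = 0 \<Longrightarrow> poly p z \<noteq> 0"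
proof -
  define R where "R p q \<longleftrightarrow> q \<noteq> 0 \<and> (\<forall>z\<in>disc. f z * poly q z = poly p z)" for p q
  \<comment> \<open>Finitely many exceptions are harmless, since f q - p is holomorphic. This covers
    the zeros of the given denominator and, later, a cancelled common zero.\<close>
  have RI: "R p q" if "q \<noteq> 0" "finite F" "\<And>z. z \<in> disc - F \<Longrightarrow> f z * poly q z = poly p z" for p q F
  proof -
    have "f z * poly q z - poly p z = 0" if "z \<in> disc" for z
      by (rule holomorphic_eq_zero_cofinite[of "\<lambda>z. f z * poly q z - poly p z" F])
        (use \<open>finite F\<close> that \<open>\<And>z. z \<in> disc - F \<Longrightarrow> f z * poly q z = poly p z\<close> f in \<open>auto intro!: holomorphic_intros\<close>)
    with \<open>q \<noteq> 0\<close> show ?thesis by (simp add: R_def)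
  qed
  obtain p q where "q \<noteq> 0" "\<And>z. z \<in> disc \<Longrightarrow> poly q z \<noteq> 0 \<Longrightarrow> f z = poly p z / poly q z"
    using assms(2) by (auto simp: rational_on_disc_def)
  then have "R p q" by (intro RI[of q "{z. poly q z = 0}"]) (auto simp: poly_roots_finite)
  define d where "d = (LEAST d. \<exists>p q. R p q \<and> degree q = d)"
  have "\<exists>p q. R p q \<and> degree q = d"
    unfolding d_def by (rule LeastI_ex) (use \<open>R p q\<close> in blast)
  then obtain p q where R: "R p q" "degree q = d" by blast
  have min: "\<not> (\<exists>p q. R p q \<and> degree q = e)" if "e < d" for e
    using that unfolding d_def by (rule not_less_Least)
  show ?thesis
  proof (rule that)
    fix z assume qz: "poly q z = 0"
    show "poly p z \<noteq> 0"
    proof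
      assume "poly p z = 0"
      with qz obtain p' q' where pq: "p = [:- z, 1:] * p'" "q = [:- z, 1:] * q'"
        by (auto simp: poly_eq_0_iff_dvd dvd_def)
      have q': "q' \<noteq> 0" using R(1) pq(2) by (auto simp: R_def)
      have "R p' q'"
      proof (rule RI[OF q', of "{z}"])
        fix w assume w: "w \<in> disc - {z}"
        then have "f w * poly q w = poly p w" using R(1) by (simp add: R_def)
        then have "(w - z) * (f w * poly q' w) = (w - z) * poly p' w"
          by (simp add: pq algebra_simps)
        then show "f w * poly q' w = poly p' w" using w by simp
      qed simp
      moreover have "degree q' < d"
        using q' R(2) unfolding pq(2) by (subst (asm) degree_mult_eq) auto
      ultimately show False using min by blast
    qed
  qed (use R in \<open>auto simp: R_def\<close>)
qed

text \<open>A nonempty open set is not null. This turns the boundary condition of inner functions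
  into an equality at every angle.\<close>

lemma AE_lborel_continuous_eq:
  fixes g h :: "real \<Rightarrow> real"
  assumes "AE t in lborel. g t = h t" "continuous_on UNIV g" "continuous_on UNIV h"
  shows "g t = h t"
proof (rule ccontr)
  assume "g t \<noteq> h t"
  have "open {t. g t \<noteq> h t}" using assms(2,3) by (rule open_Collect_neq)
  moreover have "{t. g t \<noteq> h t} \<noteq> {}" using \<open>g t \<noteq> h t\<close> by auto
  ultimately have "\<not> negligible {t. g t \<noteq> h t}" by (rule open_not_negligible)
  moreover have "{t. g t \<noteq> h t} \<in> null_sets lborel"
    using assms(1) \<open>open {t. g t \<noteq> h t}\<close> by (subst AE_iff_null_sets) auto
  ultimately show False
    using null_sets_completionI[of _ lborel] by (auto simp: negligible_iff_null_sets)
qed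

text \<open>From |f| \<le> 1 follows |p| \<le> |q| on the disc and by continuity on its closure. A
  zero of q there would be a zero of p, which is excluded for the reduced fraction. So p / q is
  continuous up to the circle and its radial limits are its values.\<close>

lemma rational_inner_disc_realizes:
  assumes "rational_inner_disc f"
  obtains n a b c D where "realizes n a b c D f"
proof -
  have f: "f holomorphic_on disc" "\<And>z. z \<in> disc \<Longrightarrow> cmod (f z) \<le> 1" "rational_on_disc f"
    and inner: "AE t in lborel. ((\<lambda>r. cmod (f (of_real r * cis t))) \<longlongrightarrow> 1) (at_left (1 :: real))"
    using assms by (auto simp: rational_inner_disc_def inner_disc_def schur_disc_def)
  obtain p q where pq: "\<And>z. z \<in> disc \<Longrightarrow> f z * poly q z = poly p z"
    and coprime: "\<And>z. poly q z = 0 \<Longrightarrow> poly p z \<noteq> 0"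
    by (rule rational_on_disc_reduced[OF f(1,3)]) (rule that)
  have le_disc: "cmod (poly p z) - cmod (poly q z) \<le> 0" if "z \<in> disc" for z
    using mult_left_le_one_le[OF norm_ge_zero norm_ge_zero f(2)[OF that], of "poly q z"]
    unfolding pq[OF that, symmetric] by (simp add: norm_mult)
  have le: "cmod (poly p z) - cmod (poly q z) \<le> 0" if "cmod z \<le> 1" for z
  proof (rule continuous_le_on_closure[where S = disc and f = "\<lambda>z. cmod (poly p z) - cmod (poly q z)"])
    show "continuous_on (closure disc) (\<lambda>z. cmod (poly p z) - cmod (poly q z))"
      by (intro continuous_intros)
  qed (use that le_disc in auto)
  have q: "poly q z \<noteq> 0" if "cmod z \<le> 1" for z
    using le[OF that] coprime[of z] by auto
  have fpq: "f z = poly p z / poly q z" if "z \<in> disc" for z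
    using pq[OF that] q[of z] that by (simp add: field_simps)
  have "AE t in lborel. cmod (poly p (cis t)) = cmod (poly q (cis t))"
    using inner
  proof eventually_elim
    case (elim t)
    have q1: "poly q (cis t) \<noteq> 0" by (rule q) simp
    have "((\<lambda>r. cmod (f (of_real r * cis t))) \<longlongrightarrow> cmod (poly p (cis t) / poly q (cis t))) (at_left (1 :: real))"
      by (rule radial_limit_quotient[OF fpq q1])
    then have "cmod (poly p (cis t) / poly q (cis t)) = 1"
      using elim by (rule tendsto_unique[OF trivial_limit_at_left_real])
    then show ?case using q1 by (simp add: norm_divide)
  qed
  moreover have "continuous_on UNIV (\<lambda>t. cmod (poly u (cis t)))" for u
    by (intro continuous_on_norm continuous_on_poly continuous_on_cis continuous_on_id)
  ultimately have circle: "cmod (poly p (cis t)) = cmod (poly q (cis t))" for t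
    by (intro AE_lborel_continuous_eq[where g = "\<lambda>t. cmod (poly p (cis t))" and h = "\<lambda>t. cmod (poly q (cis t))"])
  have unimodular: "cmod (poly (p * 1) z) = cmod (poly q z)" if "cmod z = 1" for z
  proof -
    have "z = cis (Arg z)"
      using rcis_cmod_Arg[of z] unfolding that rcis_def by simp
    then obtain t where t: "z = cis t" by blast
    show ?thesis unfolding t mult_1_right by (rule circle)
  qed
  \<comment> \<open>The induction starts with the empty product \<open>p0 = 1\<close>: no factor of
    p has been examined yet.\<close>
  have ex: "\<exists>n a b c D. realizes n a b c D (\<lambda>z. poly (p * 1) z / poly q z)"
  proof (rule unimodular_quotient_realizes)
    show "poly q z \<noteq> 0" if "cmod z \<le> 1" for z using that by (rule q)
    show "poly 1 z \<noteq> 0" for z :: complex by simp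
    show "cmod (poly (p * 1) z) = cmod (poly q z)" if "cmod z = 1" for z using that by (rule unimodular)
  qed
  have eq: "poly (p * 1) z / poly q z = f z" if "z \<in> disc" for z
    unfolding mult_1_right by (rule fpq[OF that, symmetric])
  show thesis
    using ex by (elim exE) (rule that[OF realizes_cong[OF _ eq]])
qed

section \<open>Block rows and columns, and the equivalence\<close>

lemma row_block_row:
  assumes "B1 \<in> carrier_mat 1 n1" "B2 \<in> carrier_mat 1 n2"
  shows "block_row B1 B2 \<in> carrier_mat 1 (n1 + n2)" "row (block_row B1 B2) 0 = row B1 0 @\<^sub>v row B2 0"
  using assms unfolding block_row_def by (auto intro!: eq_vecI)

lemma col_append_rows:
  assumes "C1 \<in> carrier_mat n1 1" "C2 \<in> carrier_mat n2 1"
  shows "C1 @\<^sub>r C2 \<in> carrier_mat (n1 + n2) 1" "col (C1 @\<^sub>r C2) 0 = col C1 0 @\<^sub>v col C2 0"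
  using assms unfolding append_rows_def by (auto intro!: eq_vecI)

theorem theorem5p3:
  fixes \<phi> :: "complex \<times> complex \<Rightarrow> complex"
  assumes "rational_inner_bidisc \<phi>"
    and "\<phi> (0, 0) \<noteq> 0"
  shows
    "(\<exists>n1 n2 a B1 B2 C1 C2 D1 D2 D3 V.
        B1 \<in> carrier_mat 1 n1 \<and> B2 \<in> carrier_mat 1 n2 \<and>
        C1 \<in> carrier_mat n1 1 \<and> C2 \<in> carrier_mat n2 1 \<and>
        D1 \<in> carrier_mat n1 n1 \<and> D2 \<in> carrier_mat n1 n2 \<and> D3 \<in> carrier_mat n2 n2 \<and>
        V = colligation a (block_row B1 B2) (C1 @\<^sub>r C2)
              (four_block_mat D1 D2 (0\<^sub>m n2 n1) D3) \<and>
        isometric_mat V \<and>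
        D1 \<in> class_C0 n1 \<and> D3 \<in> class_C0 n2 \<and>
        (\<forall>z\<in>bidisc. \<phi> z = transfer_function n1 n2 V z))
     \<longleftrightarrow>
     (\<exists>\<phi>1 \<phi>2. rational_inner_disc \<phi>1 \<and> rational_inner_disc \<phi>2 \<and>
        (\<forall>z\<in>bidisc. \<phi> z = \<phi>1 (fst z) * \<phi>2 (snd z)))"
  (is "?L \<longleftrightarrow> ?R")
proof
  assume ?L
  then obtain n1 n2 a B1 B2 C1 C2 D1 D2 D3 V where
    car: "B1 \<in> carrier_mat 1 n1" "B2 \<in> carrier_mat 1 n2" "C1 \<in> carrier_mat n1 1" "C2 \<in> carrier_mat n2 1"
      "D1 \<in> carrier_mat n1 n1" "D2 \<in> carrier_mat n1 n2" "D3 \<in> carrier_mat n2 n2"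
    and V: "V = colligation a (block_row B1 B2) (C1 @\<^sub>r C2) (four_block_mat D1 D2 (0\<^sub>m n2 n1) D3)"
    and isoV: "isometric_mat V" and C0: "D1 \<in> class_C0 n1" "D3 \<in> class_C0 n2"
    and \<phi>: "\<forall>z\<in>bidisc. \<phi> z = transfer_function n1 n2 V z"
    by (elim exE conjE) (rule that)
  let ?D = "four_block_mat D1 D2 (0\<^sub>m n2 n1) D3"
  have vcar: "row B1 0 \<in> carrier_vec n1" "col C1 0 \<in> carrier_vec n1" "row B2 0 \<in> carrier_vec n2" "col C2 0 \<in> carrier_vec n2"
    using car by auto
  note B = row_block_row[OF car(1,2)] and C = col_append_rows[OF car(3,4)]
  have D: "?D \<in> carrier_mat (n1 + n2) (n1 + n2)" using car by simp
  have iso: "isometric_system (n1 + n2) a (row B1 0 @\<^sub>v row B2 0) (col C1 0 @\<^sub>v col C2 0) ?D"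
    using isoV isometric_colligation_iff[OF B(1) C(1) D] by (simp add: V B C)
  \<comment> \<open>At the origin E is the zero matrix and y = 0 solves the state equation, so a is
    the value of \<phi> there.\<close>
  have "a \<noteq> 0"
  proof -
    have z: "(0, 0) \<in> bidisc" by simp
    have s: "col (C1 @\<^sub>r C2) 0 + ?D *\<^sub>v 0\<^sub>v (n1 + n2) \<in> carrier_vec (n1 + n2)"
      using iso mult_mat_vec_carrier[OF D zero_carrier_vec] unfolding C(2) by (simp add: isometric_system_def)
    have "E_mat n1 n2 (0, 0) = 0\<^sub>m (n1 + n2) (n1 + n2)"
      unfolding E_mat_def by (intro eq_matI) auto
    then have "0\<^sub>v (n1 + n2) = E_mat n1 n2 (0, 0) *\<^sub>v (col (C1 @\<^sub>r C2) 0 + ?D *\<^sub>v 0\<^sub>v (n1 + n2))"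
      using s by (simp add: zero_mult_mat_vec)
    note transfer_function_eq[OF B(1) C(1) D contraction_isometric_system[OF iso] z zero_carrier_vec this, of a]
    moreover have "row (block_row B1 B2) 0 \<bullet> 0\<^sub>v (n1 + n2) = 0"
      unfolding B(2) by (rule scalar_prod_right_zero) (use vcar in simp)
    ultimately show ?thesis using bspec[OF \<phi> z] assms(2) by (simp add: V)
  qed
  then obtain r where r: "r \<noteq> 0" "isometric_system n1 (a / r) (row B1 0) ((1 / r) \<cdot>\<^sub>v col C1 0) D1"
    "isometric_system n2 r ((r / a) \<cdot>\<^sub>v row B2 0) (col C2 0) D3"
    "D2 = outer ((1 / r) \<cdot>\<^sub>v col C1 0) ((r / a) \<cdot>\<^sub>v row B2 0)"
    by (rule isometric_system_triangular_split[OF iso vcar(1,2) car(5) vcar(3,4) car(6,7)])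
  obtain f1 where f1: "realizes n1 (a / r) (row B1 0) ((1 / r) \<cdot>\<^sub>v col C1 0) D1 f1" "rational_inner_disc f1"
    by (rule isometric_system_rational_inner[OF r(2) C0(1)])
  obtain f2 where f2: "realizes n2 r ((r / a) \<cdot>\<^sub>v row B2 0) (col C2 0) D3 f2" "rational_inner_disc f2"
    by (rule isometric_system_rational_inner[OF r(3) C0(2)])
  \<comment> \<open>V is the series connection of the two split systems: the scaling by r cancels in
    the corner, in the row and in the column.\<close>
  have V': "V = colligation (a / r * r) (block_row B1 B2) (C1 @\<^sub>r C2)
      (cascade_mat ((1 / r) \<cdot>\<^sub>v col C1 0) D1 ((r / a) \<cdot>\<^sub>v row B2 0) D3)"
    unfolding V cascade_mat_def r(4) using r(1) car by simp
  have row: "row (block_row B1 B2) 0 = row B1 0 @\<^sub>v ((a / r) \<cdot>\<^sub>v ((r / a) \<cdot>\<^sub>v row B2 0))"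
    unfolding B(2) using r(1) \<open>a \<noteq> 0\<close> by (simp add: smult_smult_assoc)
  have col: "col (C1 @\<^sub>r C2) 0 = (r \<cdot>\<^sub>v ((1 / r) \<cdot>\<^sub>v col C1 0)) @\<^sub>v col C2 0"
    unfolding C(2) using r(1) by (simp add: smult_smult_assoc)
  have "\<phi> z = f1 (fst z) * f2 (snd z)" if "z \<in> bidisc" for z
    using bspec[OF \<phi> that] transfer_function_cascade[OF f1(1) f2(1) B(1) row C(1) col that]
    unfolding V' by (rule trans)
  with f1(2) f2(2) show ?R by blast
next
  assume ?R
  then obtain \<phi>1 \<phi>2 where inner: "rational_inner_disc \<phi>1" "rational_inner_disc \<phi>2"
    and \<phi>: "\<forall>z\<in>bidisc. \<phi> z = \<phi>1 (fst z) * \<phi>2 (snd z)"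
    by blast
  obtain n1 a1 b1 c1 D1 where 1: "realizes n1 a1 b1 c1 D1 \<phi>1"
    by (rule rational_inner_disc_realizes[OF inner(1)])
  obtain n2 a2 b2 c2 D2 where 2: "realizes n2 a2 b2 c2 D2 \<phi>2"
    by (rule rational_inner_disc_realizes[OF inner(2)])
  have iso: "isometric_system n1 a1 b1 c1 D1" "isometric_system n2 a2 b2 c2 D2"
    and C0: "D1 \<in> class_C0 n1" "D2 \<in> class_C0 n2"
    using 1 2 by (auto simp: realizes_def)
  then have car: "b1 \<in> carrier_vec n1" "c1 \<in> carrier_vec n1" "D1 \<in> carrier_mat n1 n1"
    "b2 \<in> carrier_vec n2" "c2 \<in> carrier_vec n2" "D2 \<in> carrier_mat n2 n2"
    by (auto simp: isometric_system_def)
  \<comment> \<open>The second state reaches the output through the feedthrough \<open>a1\<close> of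
    system 1, and the input reaches the first state through the feedthrough \<open>a2\<close> of
    system 2.\<close>
  define B1 B2 where "B1 = mat 1 n1 (\<lambda>(_, j). b1 $ j)" and "B2 = mat 1 n2 (\<lambda>(_, j). a1 * b2 $ j)"
  define C1 C2 where "C1 = mat n1 1 (\<lambda>(i, _). a2 * c1 $ i)" and "C2 = mat n2 1 (\<lambda>(i, _). c2 $ i)"
  have BC: "B1 \<in> carrier_mat 1 n1" "B2 \<in> carrier_mat 1 n2" "C1 \<in> carrier_mat n1 1" "C2 \<in> carrier_mat n2 1"
    by (auto simp: B1_def B2_def C1_def C2_def)
  note B = row_block_row[OF BC(1,2)] and C = col_append_rows[OF BC(3,4)]
  have vecs: "row B1 0 = b1" "row B2 0 = a1 \<cdot>\<^sub>v b2" "col C1 0 = a2 \<cdot>\<^sub>v c1" "col C2 0 = c2"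
    using car by (auto simp: B1_def B2_def C1_def C2_def intro!: eq_vecI)
  let ?D = "cascade_mat c1 D1 b2 D2"
  define V where "V = colligation (a1 * a2) (block_row B1 B2) (C1 @\<^sub>r C2) ?D"
  have isoD: "isometric_system (n1 + n2) (a1 * a2) (b1 @\<^sub>v (a1 \<cdot>\<^sub>v b2)) ((a2 \<cdot>\<^sub>v c1) @\<^sub>v c2) ?D"
    by (rule isometric_system_cascade[OF iso])
  then have D: "?D \<in> carrier_mat (n1 + n2) (n1 + n2)" by (simp add: isometric_system_def)
  have "isometric_mat V"
    unfolding V_def isometric_colligation_iff[OF B(1) C(1) D] B(2) C(2) vecs by (rule isoD)
  moreover have "\<phi> z = transfer_function n1 n2 V z" if "z \<in> bidisc" for z
  proof -
    have "transfer_function n1 n2 V z = \<phi>1 (fst z) * \<phi>2 (snd z)"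
      unfolding V_def by (rule transfer_function_cascade[OF 1 2 B(1) _ C(1) _ that]) (simp_all only: B(2) C(2) vecs)
    then show ?thesis using bspec[OF \<phi> that] by simp
  qed
  moreover have "V = colligation (a1 * a2) (block_row B1 B2) (C1 @\<^sub>r C2) (four_block_mat D1 (outer c1 b2) (0\<^sub>m n2 n1) D2)"
    using car by (simp add: V_def cascade_mat_def)
  ultimately show ?L
    using BC car C0 outer_carrier[OF car(2,4)]
    by - (rule exI[of _ n1], rule exI[of _ n2], rule exI[of _ "a1 * a2"], rule exI[of _ B1], rule exI[of _ B2],
      rule exI[of _ C1], rule exI[of _ C2], rule exI[of _ D1], rule exI[of _ "outer c1 b2"], rule exI[of _ D2],
      rule exI[of _ V], intro conjI ballI)
qed

end
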